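(* Let $\Omega\subset\mathbb{R}^n$ be open and $f,g\in\mathcal{G}(\Omega)$. Then: (1) If $g\in halo(f)$ then $g\approx f$. (2) $B_1(0)=halo(0)\subset\mathcal{G}(\Omega)_0$. (3) If $\|f\|_m\in\overline{\mathbb{K}}_0$ for all $m$, then $f\in\mathcal{G}(\Omega)_0$. (4) If $Im(f)\subset\overline{\mathbb{K}}_0$ then $f\in\mathcal{G}(\Omega)_0$. (5) $\mathcal{G}(\Omega)_{as}=\mathcal{D}'(\Omega)+\mathcal{G}(\Omega)_0$.
   Context: $I=]0,1]$, $\mathbb{K}\in\{\mathbb{R},\mathbb{C}\}$. $\overline{\mathbb{K}}$ (Colombeau generalized numbers): nets $(x_\varepsilon)_{\varepsilon\in I}$ in $\mathbb{K}$ with $|x_\varepsilon|<\varepsilon^{r}$ for some $r\in\mathbb{R}$ and all small $\varepsilon$, modulo nets with $|x_\varepsilon|<\varepsilon^{q}$ for every $q\in\mathbb{N}$ and all small $\varepsilon$. $\overline{\mathbb{K}}_0=\{x\in\overline{\mathbb{K}}: x\approx0\}$, where $x=[(x_\varepsilon)]\approx0$ means $x_\varepsilon\to0$ as $\varepsilon\to0$. $\mathcal{G}(\Omega)$ is the simplified Colombeau algebra: nets $(f_\varepsilon)$ in $C^\infty(\Omega)$ such that for each compact $K\subset\Omega$ and multi-index $\beta$, $\sup_K|\partial^\beta f_\varepsilon|<\varepsilon^{r}$ for some $r\in\mathbb{R}$ and all small $\varepsilon$, modulo nets for which this holds for every $K$, $\beta$ and every $r\in\mathbb{N}$. $\mathcal{D}'(\Omega)$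 is regarded as a linear subspace of $\mathcal{G}(\Omega)$ via the usual embedding (convolution with $\rho_\varepsilon=\varepsilon^{-n}\rho(\cdot/\varepsilon)$, $\rho\in\mathcal S(\mathbb{R}^n)$ a mollifier with integral $1$ and all higher moments zero, for compactly supported distributions, extended to all of $\mathcal{D}'(\Omega)$ by the sheaf property). Elements $f=[(f_\varepsilon)]$ define functions $\widetilde\Omega_c\to\overline{\mathbb{K}}$, $f([(x_\varepsilon)])=[(f_\varepsilon(x_\varepsilon))]$, where $\widetilde\Omega_c\subset\overline{\mathbb{R}}^n$ is the set of classes (modulo negligible nets) of nets $(x_\varepsilon)$ lying, for small $\varepsilon$, in a fixed relatively compact subset of $\Omega$ (closure contained in $\Omega$); $Im(f)$ is the image of this function. For $\varphi\in\mathcal{D}(\Omega)$ (test functions), $\int_\Omega f\varphi\,dx=[(\int_\Omega f_\varepsilon\varphi\,dx)]\in\overline{\mathbb{K}}$. Association: $f\approx g$ iff $\int_\Omega(f-g)\varphi\,dx\in\overline{\mathbb{K}}_0$ for all $\varphi\in\mathcal{D}(\Omega)$. $\mathcal{G}(\Omega)_0=\{f:f\approx0\}$; $\mathcal{G}(\Omega)_{as}=\{f:\exists T\in\mathcal{D}'(\Omega),\ f\approx T\}$. Fix an exhaustion $(\Omega_m)_{m\in\mathbb{N}}$ of $\Omega$ by relatively compact open subsets. $\|f\|_m=[(\sup_{\Omega_m}|f_\varepsilon|)]\in\overline{\mathbb{R}}$. Put $V_{mp}(f)=\sup\{a\in\mathbb{R}:\forall|\beta|\le p,\ \sup_{\Omega_m}|\partial^\beta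 f_\varepsilon|=o(\varepsilon^a)\ (\varepsilon\to0)\}$, $D_{mp}(f,g)=\exp(-V_{mp}(f-g))$ and $D(f,g)=\sup_{m}\frac{2D_{mm}(f,g)}{1+D_{mm}(f,g)}$ (this metric gives the sharp topology). $B_1(f)=\{g:D(f,g)<1\}$ and $halo(f)=f+B_1(0)=B_1(f)$. *)

theory Defs
  imports "HOL-Analysis.Analysis" "HOL-Library.Landau_Symbols"
begin

text \<open>
  The scalar field is a type \<open>'k\<close> of sort \<open>{real_normed_field, euclidean_space}\<close>. The instances
  \<open>real\<close> and \<open>complex\<close> are, up to isomorphism, the only ones, since a finite-dimensional commutative
  real division algebra is the real or the complex field.

  Nets indexed by the interval from 0 (excluded) to 1 are functions on \<open>real\<close>; their values at other
  indices are ignored. Likewise a function on an open set \<open>\<Omega>\<close> is a total function whose values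
  outside \<open>\<Omega>\<close> are ignored. Elements of the quotients are equivalence classes of nets, and
  operations on classes are computed on the representative chosen by \<open>rep\<close>; all of them are
  independent of the choice of representative.
\<close>

definition rep :: "'a set \<Rightarrow> 'a" where
  "rep X = (SOME x. x \<in> X)"


section \<open>Smooth functions\<close>

text \<open>
  A multi-index of order \<open>p\<close> is given as a list of \<open>p\<close> coordinate directions. For smooth functions
  the order of differentiation is irrelevant, so only the number of occurrences of each direction
  matters.
\<close>

definition partial :: "'n::finite \<Rightarrow> (real^'n \<Rightarrow> 'k::real_normed_vector) \<Rightarrow> real^'n \<Rightarrow> 'k" where
  "partial i f x = frechet_derivative f (at x) (axis i 1)"

definition partials :: "'n::finite list \<Rightarrow> (real^'n \<Rightarrow> 'k::real_normed_vector) \<Rightarrow> real^'n \<Rightarrow> 'k" where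
  "partials \<beta> = foldr partial \<beta>"

definition smooth_on :: "(real^'n) set \<Rightarrow> (real^'n \<Rightarrow> 'k::real_normed_vector) \<Rightarrow> bool" where
  "smooth_on \<Omega> f \<longleftrightarrow> (\<forall>\<beta>. \<forall>x\<in>\<Omega>. partials \<beta> f differentiable (at x))"

text \<open>The element 0 is inserted so that the supremum over the empty set is 0.\<close>

definition sup_norm :: "'a set \<Rightarrow> ('a \<Rightarrow> 'k::real_normed_vector) \<Rightarrow> real" where
  "sup_norm S f = Sup (insert 0 ((\<lambda>x. norm (f x)) ` S))"

definition supp :: "('a::topological_space \<Rightarrow> 'k::zero) \<Rightarrow> 'a set" where
  "supp f = closure {x. f x \<noteq> 0}"

definition test_functions :: "(real^'n) set \<Rightarrow> (real^'n \<Rightarrow> 'k::real_normed_vector) set" where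
  "test_functions \<Omega> = {\<phi>. smooth_on UNIV \<phi> \<and> compact (supp \<phi>) \<and> supp \<phi> \<subseteq> \<Omega>}"

definition rel_compact_in :: "'a::topological_space set \<Rightarrow> 'a set \<Rightarrow> bool" where
  "rel_compact_in S \<Omega> \<longleftrightarrow> compact (closure S) \<and> closure S \<subseteq> \<Omega>"


section \<open>Generalized numbers and points\<close>

definition gn_moderate :: "(real \<Rightarrow> 'v::real_normed_vector) \<Rightarrow> bool" where
  "gn_moderate x \<longleftrightarrow> (\<exists>r::real. \<forall>\<^sub>F \<epsilon> in at_right 0. norm (x \<epsilon>) < \<epsilon> powr r)"

definition gn_negligible :: "(real \<Rightarrow> 'v::real_normed_vector) \<Rightarrow> bool" where
  "gn_negligible x \<longleftrightarrow> (\<forall>q::nat. \<forall>\<^sub>F \<epsilon> in at_right 0. norm (x \<epsilon>) < \<epsilon> ^ q)"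

definition gn_rel :: "((real \<Rightarrow> 'v::real_normed_vector) \<times> (real \<Rightarrow> 'v)) set" where
  "gn_rel = {(x, y). gn_moderate x \<and> gn_moderate y \<and> gn_negligible (\<lambda>\<epsilon>. x \<epsilon> - y \<epsilon>)}"

definition gn_class :: "(real \<Rightarrow> 'v::real_normed_vector) \<Rightarrow> (real \<Rightarrow> 'v) set" where
  "gn_class x = gn_rel `` {x}"

definition gen_numbers :: "(real \<Rightarrow> 'v::real_normed_vector) set set" where
  "gen_numbers = {x. gn_moderate x} // gn_rel"

definition gn_infinitesimals :: "(real \<Rightarrow> 'v::real_normed_vector) set set" where
  "gn_infinitesimals = {X \<in> gen_numbers. (rep X \<longlongrightarrow> 0) (at_right 0)}"

definition gn_of_real :: "(real \<Rightarrow> real) set \<Rightarrow> (real \<Rightarrow> 'k::real_normed_field) set" where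
  "gn_of_real X = gn_class (\<lambda>\<epsilon>. of_real (rep X \<epsilon>))"

definition compact_points :: "(real^'n) set \<Rightarrow> (real \<Rightarrow> real^'n) set set" where
  "compact_points \<Omega> =
     {gn_class x | x. gn_moderate x \<and>
        (\<exists>S. rel_compact_in S \<Omega> \<and> (\<forall>\<^sub>F \<epsilon> in at_right 0. x \<epsilon> \<in> S))}"


section \<open>The Colombeau algebra\<close>

type_synonym ('n, 'k) net = "real \<Rightarrow> real^'n \<Rightarrow> 'k"

definition moderate :: "(real^'n) set \<Rightarrow> ('n::finite, 'k::real_normed_vector) net \<Rightarrow> bool" where
  "moderate \<Omega> f \<longleftrightarrow>
     (\<forall>\<epsilon>\<in>{0<..1}. smooth_on \<Omega> (f \<epsilon>)) \<and>
     (\<forall>K \<beta>. compact K \<and> K \<subseteq> \<Omega> \<longrightarrow>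
        (\<exists>r::real. \<forall>\<^sub>F \<epsilon> in at_right 0. sup_norm K (partials \<beta> (f \<epsilon>)) < \<epsilon> powr r))"

definition negligible_net :: "(real^'n) set \<Rightarrow> ('n::finite, 'k::real_normed_vector) net \<Rightarrow> bool" where
  "negligible_net \<Omega> f \<longleftrightarrow>
     (\<forall>\<epsilon>\<in>{0<..1}. smooth_on \<Omega> (f \<epsilon>)) \<and>
     (\<forall>K \<beta>. compact K \<and> K \<subseteq> \<Omega> \<longrightarrow>
        (\<forall>q::nat. \<forall>\<^sub>F \<epsilon> in at_right 0. sup_norm K (partials \<beta> (f \<epsilon>)) < \<epsilon> ^ q))"

definition gf_rel ::
    "(real^'n) set \<Rightarrow> (('n::finite, 'k::real_normed_vector) net \<times> ('n, 'k) net) set" where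
  "gf_rel \<Omega> = {(f, g). moderate \<Omega> f \<and> moderate \<Omega> g \<and> negligible_net \<Omega> (\<lambda>\<epsilon> x. f \<epsilon> x - g \<epsilon> x)}"

definition gf_class ::
    "(real^'n) set \<Rightarrow> ('n::finite, 'k::real_normed_vector) net \<Rightarrow> ('n, 'k) net set" where
  "gf_class \<Omega> f = gf_rel \<Omega> `` {f}"

definition colombeau :: "(real^'n) set \<Rightarrow> ('n::finite, 'k::real_normed_vector) net set set" where
  "colombeau \<Omega> = {f. moderate \<Omega> f} // gf_rel \<Omega>"

definition gf_zero :: "(real^'n) set \<Rightarrow> ('n::finite, 'k::real_normed_vector) net set" where
  "gf_zero \<Omega> = gf_class \<Omega> (\<lambda>\<epsilon> x. 0)"

definition gf_add ::
    "(real^'n) set \<Rightarrow> ('n::finite, 'k::real_normed_vector) net set \<Rightarrow> ('n, 'k) net set \<Rightarrow> ('n, 'k) net set"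
  where "gf_add \<Omega> f g = gf_class \<Omega> (\<lambda>\<epsilon> x. rep f \<epsilon> x + rep g \<epsilon> x)"

definition gf_diff ::
    "(real^'n) set \<Rightarrow> ('n::finite, 'k::real_normed_vector) net set \<Rightarrow> ('n, 'k) net set \<Rightarrow> ('n, 'k) net set"
  where "gf_diff \<Omega> f g = gf_class \<Omega> (\<lambda>\<epsilon> x. rep f \<epsilon> x - rep g \<epsilon> x)"

definition gf_restrict ::
    "(real^'n) set \<Rightarrow> ('n::finite, 'k::real_normed_vector) net set \<Rightarrow> ('n, 'k) net set" where
  "gf_restrict \<omega> f = gf_class \<omega> (rep f)"

definition gf_eval ::
    "('n::finite, 'k::real_normed_vector) net set \<Rightarrow> (real \<Rightarrow> real^'n) set \<Rightarrow> (real \<Rightarrow> 'k) set" where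
  "gf_eval f X = gn_class (\<lambda>\<epsilon>. rep f \<epsilon> (rep X \<epsilon>))"

definition gf_image ::
    "(real^'n) set \<Rightarrow> ('n::finite, 'k::real_normed_vector) net set \<Rightarrow> (real \<Rightarrow> 'k) set set" where
  "gf_image \<Omega> f = gf_eval f ` compact_points \<Omega>"

definition gf_integral ::
    "(real^'n) set \<Rightarrow> ('n::finite, 'k::{real_normed_field, euclidean_space}) net set \<Rightarrow>
     (real^'n \<Rightarrow> 'k) \<Rightarrow> (real \<Rightarrow> 'k) set" where
  "gf_integral \<Omega> f \<phi> = gn_class (\<lambda>\<epsilon>. set_lebesgue_integral lborel \<Omega> (\<lambda>x. rep f \<epsilon> x * \<phi> x))"

definition associated ::
    "(real^'n) set \<Rightarrow> ('n::finite, 'k::{real_normed_field, euclidean_space}) net set \<Rightarrow>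
     ('n, 'k) net set \<Rightarrow> bool" where
  "associated \<Omega> f g \<longleftrightarrow>
     (\<forall>\<phi>\<in>test_functions \<Omega>. gf_integral \<Omega> (gf_diff \<Omega> f g) \<phi> \<in> gn_infinitesimals)"

definition colombeau_0 ::
    "(real^'n) set \<Rightarrow> ('n::finite, 'k::{real_normed_field, euclidean_space}) net set set" where
  "colombeau_0 \<Omega> = {f \<in> colombeau \<Omega>. associated \<Omega> f (gf_zero \<Omega>)}"


section \<open>Distributions and their embedding\<close>

text \<open>Only the values of \<open>T\<close> on test functions are relevant.\<close>

definition distribution ::
    "(real^'n) set \<Rightarrow> ((real^'n \<Rightarrow> 'k::real_normed_field) \<Rightarrow> 'k) \<Rightarrow> bool" where
  "distribution \<Omega> T \<longleftrightarrow>
     (\<forall>\<phi>\<in>test_functions \<Omega>. \<forall>\<psi>\<in>test_functions \<Omega>. T (\<lambda>x. \<phi> x + \<psi> x) = T \<phi> + T \<psi>) \<and>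
     (\<forall>c. \<forall>\<phi>\<in>test_functions \<Omega>. T (\<lambda>x. c * \<phi> x) = c * T \<phi>) \<and>
     (\<forall>K. compact K \<and> K \<subseteq> \<Omega> \<longrightarrow>
        (\<exists>C N. \<forall>\<phi>\<in>test_functions \<Omega>. supp \<phi> \<subseteq> K \<longrightarrow>
           norm (T \<phi>) \<le> C * (\<Sum>\<beta> | length \<beta> \<le> N. sup_norm K (partials \<beta> \<phi>))))"

definition monomial :: "'n::finite list \<Rightarrow> real^'n \<Rightarrow> real" where
  "monomial \<alpha> x = (\<Prod>i\<leftarrow>\<alpha>. x $ i)"

definition schwartz :: "(real^'n \<Rightarrow> 'k::real_normed_vector) \<Rightarrow> bool" where
  "schwartz \<rho> \<longleftrightarrow>
     smooth_on UNIV \<rho> \<and> (\<forall>\<alpha> \<beta>. bounded (range (\<lambda>x. monomial \<alpha> x *\<^sub>R partials \<beta> \<rho> x)))"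

definition mollifier :: "(real^'n \<Rightarrow> 'k::{real_normed_field, euclidean_space}) \<Rightarrow> bool" where
  "mollifier \<rho> \<longleftrightarrow>
     schwartz \<rho> \<and> (LINT x|lborel. \<rho> x) = 1 \<and>
     (\<forall>\<alpha>. \<alpha> \<noteq> [] \<longrightarrow> (LINT x|lborel. monomial \<alpha> x *\<^sub>R \<rho> x) = 0)"

definition scaled :: "(real^'n \<Rightarrow> 'k::real_normed_vector) \<Rightarrow> real \<Rightarrow> real^'n \<Rightarrow> 'k" where
  "scaled \<rho> \<epsilon> x = (1 / \<epsilon> ^ CARD('n)) *\<^sub>R \<rho> ((1 / \<epsilon>) *\<^sub>R x)"

text \<open>The convolution of \<open>\<theta>\<close> with the compactly supported distribution \<open>\<eta> T\<close>.\<close>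

definition cutoff_conv ::
    "(real^'n \<Rightarrow> 'k::real_normed_field) \<Rightarrow> ((real^'n \<Rightarrow> 'k) \<Rightarrow> 'k) \<Rightarrow> (real^'n \<Rightarrow> 'k) \<Rightarrow> real^'n \<Rightarrow> 'k" where
  "cutoff_conv \<eta> T \<theta> x = T (\<lambda>y. \<eta> y * \<theta> (x - y))"

text \<open>
  \<open>f\<close> is the image of \<open>T\<close> under the embedding of distributions: the embedding is convolution with
  the scaled mollifier on compactly supported distributions, and it is extended by the sheaf
  property, so that the image of \<open>T\<close> is the unique \<open>f\<close> which on every relatively compact open
  \<open>\<omega>\<close> agrees with the image of \<open>\<eta> T\<close>, for every cutoff \<open>\<eta>\<close> that is 1 near the closure of \<open>\<omega>\<close>.
\<close>

definition embeds ::
    "(real^'n \<Rightarrow> 'k::real_normed_field) \<Rightarrow> (real^'n) set \<Rightarrow> ((real^'n \<Rightarrow> 'k) \<Rightarrow> 'k) \<Rightarrow>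
     ('n::finite, 'k) net set \<Rightarrow> bool" where
  "embeds \<rho> \<Omega> T f \<longleftrightarrow> f \<in> colombeau \<Omega> \<and>
     (\<forall>\<omega>. \<forall>\<eta>\<in>test_functions \<Omega>.
        open \<omega> \<and> rel_compact_in \<omega> \<Omega> \<and> (\<exists>U. open U \<and> closure \<omega> \<subseteq> U \<and> (\<forall>x\<in>U. \<eta> x = 1)) \<longrightarrow>
        gf_restrict \<omega> f = gf_class \<omega> (\<lambda>\<epsilon>. cutoff_conv \<eta> T (scaled \<rho> \<epsilon>)))"

definition distributions ::
    "(real^'n \<Rightarrow> 'k::real_normed_field) \<Rightarrow> (real^'n) set \<Rightarrow> ('n::finite, 'k) net set set" where
  "distributions \<rho> \<Omega> = {f. \<exists>T. distribution \<Omega> T \<and> embeds \<rho> \<Omega> T f}"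

definition colombeau_as ::
    "(real^'n \<Rightarrow> 'k::{real_normed_field, euclidean_space}) \<Rightarrow> (real^'n) set \<Rightarrow>
     ('n::finite, 'k) net set set" where
  "colombeau_as \<rho> \<Omega> = {f \<in> colombeau \<Omega>. \<exists>t\<in>distributions \<rho> \<Omega>. associated \<Omega> f t}"


section \<open>Sharp topology\<close>

definition exhaustion :: "'a::topological_space set \<Rightarrow> (nat \<Rightarrow> 'a set) \<Rightarrow> bool" where
  "exhaustion \<Omega> E \<longleftrightarrow>
     (\<forall>m. open (E m) \<and> rel_compact_in (E m) \<Omega>) \<and> mono E \<and> (\<Union>m. E m) = \<Omega>"

definition gf_norm ::
    "(nat \<Rightarrow> (real^'n) set) \<Rightarrow> nat \<Rightarrow> ('n::finite, 'k::real_normed_vector) net set \<Rightarrow> (real \<Rightarrow> real) set" where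
  "gf_norm E m f = gn_class (\<lambda>\<epsilon>. sup_norm (E m) (rep f \<epsilon>))"

definition valuation ::
    "(nat \<Rightarrow> (real^'n) set) \<Rightarrow> nat \<Rightarrow> nat \<Rightarrow> ('n::finite, 'k::real_normed_vector) net set \<Rightarrow> ereal" where
  "valuation E m p f =
     Sup (ereal ` {a. \<forall>\<beta>. length \<beta> \<le> p \<longrightarrow>
            (\<lambda>\<epsilon>. sup_norm (E m) (partials \<beta> (rep f \<epsilon>))) \<in> o[at_right 0](\<lambda>\<epsilon>. \<epsilon> powr a)})"

text \<open>The valuation of an element of the algebra is never \<open>-\<infinity>\<close>.\<close>

definition exp_minus :: "ereal \<Rightarrow> real" where
  "exp_minus v = (if v = \<infinity> then 0 else exp (- real_of_ereal v))"

definition sharp_semidist ::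
    "(real^'n) set \<Rightarrow> (nat \<Rightarrow> (real^'n) set) \<Rightarrow> nat \<Rightarrow> nat \<Rightarrow>
     ('n::finite, 'k::real_normed_vector) net set \<Rightarrow> ('n, 'k) net set \<Rightarrow> real" where
  "sharp_semidist \<Omega> E m p f g = exp_minus (valuation E m p (gf_diff \<Omega> f g))"

definition sharp_dist ::
    "(real^'n) set \<Rightarrow> (nat \<Rightarrow> (real^'n) set) \<Rightarrow>
     ('n::finite, 'k::real_normed_vector) net set \<Rightarrow> ('n, 'k) net set \<Rightarrow> real" where
  "sharp_dist \<Omega> E f g =
     (SUP m. 2 * sharp_semidist \<Omega> E m m f g / (1 + sharp_semidist \<Omega> E m m f g))"

definition unit_ball ::
    "(real^'n) set \<Rightarrow> (nat \<Rightarrow> (real^'n) set) \<Rightarrow>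
     ('n::finite, 'k::real_normed_vector) net set \<Rightarrow> ('n, 'k) net set set" where
  "unit_ball \<Omega> E f = {g \<in> colombeau \<Omega>. sharp_dist \<Omega> E f g < 1}"

definition halo ::
    "(real^'n) set \<Rightarrow> (nat \<Rightarrow> (real^'n) set) \<Rightarrow>
     ('n::finite, 'k::real_normed_vector) net set \<Rightarrow> ('n, 'k) net set set" where
  "halo \<Omega> E f = gf_add \<Omega> f ` unit_ball \<Omega> E (gf_zero \<Omega>)"

end

theory Submission
  imports Defs
begin

text \<open>
  All statements reduce to one observation: if \<open>f\<^sub>\<epsilon> \<rightarrow> 0\<close> uniformly on compact sets, then
  \<open>\<integral> f\<^sub>\<epsilon> \<phi> \<rightarrow> 0\<close>, being bounded by the supremum over \<open>supp \<phi>\<close> times a constant. For \<open>h\<close> in the unit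
  ball around 0 the valuations are positive, so \<open>sup |h\<^sub>\<epsilon>| = o(\<epsilon>\<^sup>a)\<close> with \<open>a > 0\<close>. If all point values
  are infinitesimal, evaluate at points \<open>x\<^sub>\<epsilon>\<close> where \<open>|f\<^sub>\<epsilon>|\<close> is maximal on \<open>K\<close>. The claims about \<open>halo\<close>
  and \<open>\<G>\<^sub>a\<^sub>s\<close> then follow from \<open>(f + h) - f = h\<close> in the group of classes.
\<close>

section \<open>Growth of nets\<close>

lemma eventually_at_right_0_less:
  "\<forall>\<^sub>F \<epsilon>::real in at_right 0. 0 < \<epsilon> \<and> \<epsilon> < a" if "0 < a"
  using that by (auto simp: eventually_at_right_field intro!: exI[of _ a])

lemma eventually_at_right_0_unit: "\<forall>\<^sub>F \<epsilon>::real in at_right 0. \<epsilon> \<in> {0<..1}"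
  by (rule eventually_mono[OF eventually_at_right_0_less[of 1]]) auto

lemma eventually_less_powr_mono:
  assumes "\<forall>\<^sub>F \<epsilon> in at_right 0. u \<epsilon> < \<epsilon> powr r" "s \<le> r"
  shows "\<forall>\<^sub>F \<epsilon>::real in at_right 0. u \<epsilon> < \<epsilon> powr s"
  using assms(1) eventually_at_right_0_less[OF zero_less_one]
proof eventually_elim
  case (elim \<epsilon>)
  then have "\<epsilon> powr r \<le> \<epsilon> powr s"
    using assms(2) by (intro powr_mono') auto
  with elim show ?case by simp
qed

text \<open>Giving up one power of \<epsilon> absorbs any constant factor. The loss is harmless:
  moderateness asks for some exponent, negligibility for all of them.\<close>

lemma eventually_less_powr_combine:
  fixes u v w :: "real \<Rightarrow> real"
  assumes "\<forall>\<^sub>F \<epsilon> in at_right 0. u \<epsilon> < \<epsilon> powr r" "\<forall>\<^sub>F \<epsilon> in at_right 0. v \<epsilon> < \<epsilon> powr r"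
    and "\<forall>\<^sub>F \<epsilon> in at_right 0. w \<epsilon> \<le> C * (u \<epsilon> + v \<epsilon>)"
    and "0 \<le> C"
  shows "\<forall>\<^sub>F \<epsilon> in at_right 0. w \<epsilon> < \<epsilon> powr (r - 1)"
proof -
  \<comment> \<open>The summand 1 in \<open>2 * C + 1\<close> keeps the denominator positive for
    \<open>C = 0\<close> and makes the later estimate strict.\<close>
  have "\<forall>\<^sub>F \<epsilon>::real in at_right 0. 0 < \<epsilon> \<and> \<epsilon> < 1 / (2 * C + 1)"
    by (rule eventually_at_right_0_less) (use assms(4) in auto)
  with assms(1-3) show ?thesis
  proof eventually_elim
    case (elim \<epsilon>)
    have "w \<epsilon> \<le> C * (\<epsilon> powr r + \<epsilon> powr r)"
      using elim assms(4) by (intro order_trans[OF elim(3)] mult_left_mono) auto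
    also have "\<dots> < (2 * C + 1) * \<epsilon> powr r"
      using elim by (simp add: algebra_simps)
    also have "\<dots> \<le> (1 / \<epsilon>) * \<epsilon> powr r"
      using elim assms(4) by (intro mult_right_mono) (auto simp: field_simps)
    also have "\<dots> = \<epsilon> powr (r - 1)"
      using elim by (simp add: powr_diff)
    finally show ?case .
  qed
qed

text \<open>With real exponents, negligible and moderate nets are compared with the same functions
  \<open>\<epsilon> powr r\<close>, so one estimate serves both. Since \<epsilon> is eventually
  below 1, a natural exponent above r suffices.\<close>

lemma gn_negligible_powr:
  "gn_negligible x \<longleftrightarrow> (\<forall>r::real. \<forall>\<^sub>F \<epsilon> in at_right 0. norm (x \<epsilon>) < \<epsilon> powr r)"
proof
  assume x: "gn_negligible x"
  show "\<forall>r::real. \<forall>\<^sub>F \<epsilon> in at_right 0. norm (x \<epsilon>) < \<epsilon> powr r"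
  proof
    fix r :: real
    obtain q :: nat where q: "r \<le> real q" using real_arch_simple by blast
    have "\<forall>\<^sub>F \<epsilon> in at_right 0. norm (x \<epsilon>) < \<epsilon> ^ q"
      using x by (simp add: gn_negligible_def)
    then have "\<forall>\<^sub>F \<epsilon> in at_right 0. norm (x \<epsilon>) < \<epsilon> powr real q"
      using eventually_at_right_0_unit by eventually_elim (simp add: powr_realpow)
    then show "\<forall>\<^sub>F \<epsilon> in at_right 0. norm (x \<epsilon>) < \<epsilon> powr r"
      using q by (rule eventually_less_powr_mono)
  qed
next
  assume x: "\<forall>r::real. \<forall>\<^sub>F \<epsilon> in at_right 0. norm (x \<epsilon>) < \<epsilon> powr r"
  show "gn_negligible x"
    unfolding gn_negligible_def
  proof
    fix q :: nat
    show "\<forall>\<^sub>F \<epsilon> in at_right 0. norm (x \<epsilon>) < \<epsilon> ^ q"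
      using x[rule_format, of "real q"] eventually_at_right_0_unit
      by eventually_elim (simp add: powr_realpow)
  qed
qed

text \<open>Stated with an eventual inequality and a free constant, this covers sums, differences,
  multiples and domination at once.\<close>

lemma gn_moderate_combine:
  assumes "gn_moderate y" "gn_moderate z"
    and "\<forall>\<^sub>F \<epsilon> in at_right 0. norm (x \<epsilon>) \<le> C * (norm (y \<epsilon>) + norm (z \<epsilon>))"
    and "0 \<le> C"
  shows "gn_moderate x"
proof -
  obtain r s where r: "\<forall>\<^sub>F \<epsilon> in at_right 0. norm (y \<epsilon>) < \<epsilon> powr r"
    and s: "\<forall>\<^sub>F \<epsilon> in at_right 0. norm (z \<epsilon>) < \<epsilon> powr s"
    using assms by (auto simp: gn_moderate_def)
  have "\<forall>\<^sub>F \<epsilon> in at_right 0. norm (x \<epsilon>) < \<epsilon> powr (min r s - 1)"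
    using eventually_less_powr_mono[OF r] eventually_less_powr_mono[OF s] assms(3,4)
    by (intro eventually_less_powr_combine[where C = C]) auto
  then show ?thesis unfolding gn_moderate_def by blast
qed

lemma gn_negligible_combine:
  assumes "gn_negligible y" "gn_negligible z"
    and "\<forall>\<^sub>F \<epsilon> in at_right 0. norm (x \<epsilon>) \<le> C * (norm (y \<epsilon>) + norm (z \<epsilon>))"
    and "0 \<le> C"
  shows "gn_negligible x"
  unfolding gn_negligible_powr
proof
  fix r :: real
  have "\<forall>\<^sub>F \<epsilon> in at_right 0. norm (x \<epsilon>) < \<epsilon> powr ((r + 1) - 1)"
    using assms by (intro eventually_less_powr_combine[where C = C]) (auto simp: gn_negligible_powr)
  then show "\<forall>\<^sub>F \<epsilon> in at_right 0. norm (x \<epsilon>) < \<epsilon> powr r" by simp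
qed

lemma gn_moderate_le:
  assumes "gn_moderate y" "\<forall>\<^sub>F \<epsilon> in at_right 0. norm (x \<epsilon>) \<le> norm (y \<epsilon>)"
  shows "gn_moderate x"
  \<comment> \<open>The dominating net is used twice, so the constant 1/2 gives exactly its
    norm.\<close>
  by (rule gn_moderate_combine[of y y x "1 / 2", OF assms(1,1) eventually_mono[OF assms(2)]]) auto

lemma gn_moderate_0: "gn_moderate (\<lambda>\<epsilon>. 0)"
  unfolding gn_moderate_def
  by (intro exI[of _ 0] eventually_mono[OF eventually_at_right_0_unit]) auto

lemma gn_negligible_0: "gn_negligible (\<lambda>\<epsilon>. 0)"
  unfolding gn_negligible_powr
  by (intro allI eventually_mono[OF eventually_at_right_0_unit]) auto

lemma gn_moderate_sum:
  assumes "finite I" "\<And>i. i \<in> I \<Longrightarrow> gn_moderate (x i)"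
  shows "gn_moderate (\<lambda>\<epsilon>. \<Sum>i\<in>I. x i \<epsilon>)"
  using assms
proof (induction I rule: finite_induct)
  case empty
  then show ?case by (simp add: gn_moderate_0)
next
  case (insert i I)
  then show ?case
    by (simp, intro gn_moderate_combine[of "x i" "\<lambda>\<epsilon>. \<Sum>i\<in>I. x i \<epsilon>" "\<lambda>\<epsilon>. x i \<epsilon> + (\<Sum>i\<in>I. x i \<epsilon>)" 1])
      (auto intro!: always_eventually norm_triangle_ineq)
qed

text \<open>Negligible nets form an ideal: if B is below \<epsilon> to the power s, then d is taken
  below \<epsilon> to the power r - s.\<close>

lemma gn_negligible_mult_moderate:
  fixes B d :: "real \<Rightarrow> real"
  assumes "gn_moderate B" "gn_negligible d"
  shows "gn_negligible (\<lambda>\<epsilon>. B \<epsilon> * d \<epsilon>)"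
  unfolding gn_negligible_powr
proof
  fix r :: real
  obtain s where s: "\<forall>\<^sub>F \<epsilon> in at_right 0. norm (B \<epsilon>) < \<epsilon> powr s"
    using assms by (auto simp: gn_moderate_def)
  have "\<forall>\<^sub>F \<epsilon> in at_right 0. norm (d \<epsilon>) < \<epsilon> powr (r - s)"
    using assms by (auto simp: gn_negligible_powr)
  with s show "\<forall>\<^sub>F \<epsilon> in at_right 0. norm (B \<epsilon> * d \<epsilon>) < \<epsilon> powr r"
  proof eventually_elim
    case (elim \<epsilon>)
    then have "norm (B \<epsilon>) * norm (d \<epsilon>) < \<epsilon> powr s * \<epsilon> powr (r - s)"
      by (intro mult_strict_mono') auto
    also have "\<dots> = \<epsilon> powr r" by (simp flip: powr_add)
    finally show ?case by (simp add: abs_mult)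
  qed
qed

lemma gn_negligible_tendsto_0:
  assumes "gn_negligible x"
  shows "(x \<longlongrightarrow> 0) (at_right 0)"
proof (rule Lim_null_comparison)
  have "\<forall>\<^sub>F \<epsilon> in at_right 0. norm (x \<epsilon>) < \<epsilon> ^ 1"
    using assms unfolding gn_negligible_def by blast
  then show "\<forall>\<^sub>F \<epsilon> in at_right 0. norm (x \<epsilon>) \<le> \<epsilon>"
    by (rule eventually_mono) simp
qed (rule tendsto_ident_at)

lemma tendsto_0_gn_moderate:
  assumes "(x \<longlongrightarrow> 0) (at_right 0)"
  shows "gn_moderate x"
proof -
  have "\<forall>\<^sub>F \<epsilon> in at_right 0. norm (x \<epsilon>) < 1"
    using assms by (auto simp: tendsto_iff)
  then have "\<forall>\<^sub>F \<epsilon> in at_right 0. norm (x \<epsilon>) < \<epsilon> powr 0"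
    using eventually_at_right_0_unit by eventually_elim simp
  then show ?thesis unfolding gn_moderate_def by blast
qed

lemma gn_moderate_bounded:
  assumes "\<forall>\<^sub>F \<epsilon> in at_right 0. norm (x \<epsilon>) \<le> B"
  shows "gn_moderate x"
proof -
  have "\<forall>\<^sub>F \<epsilon>::real in at_right 0. 0 < \<epsilon> \<and> \<epsilon> < 1 / (\<bar>B\<bar> + 1)"
    by (rule eventually_at_right_0_less) auto
  \<comment> \<open>The exponent -1 works for every bound, as 1/\<epsilon> eventually exceeds any
    constant; \<open>\<bar>B\<bar> + 1\<close> also handles negative B.\<close>
  with assms have "\<forall>\<^sub>F \<epsilon> in at_right 0. norm (x \<epsilon>) < \<epsilon> powr (- 1)"
  proof eventually_elim
    case (elim \<epsilon>)
    then have "\<bar>B\<bar> + 1 < 1 / \<epsilon>"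
      by (simp add: field_simps)
    moreover have "\<epsilon> powr (- 1) = 1 / \<epsilon>"
      using elim by (simp add: powr_minus_divide)
    ultimately show ?case using elim by linarith
  qed
  then show ?thesis unfolding gn_moderate_def by blast
qed

section \<open>Classes of generalized numbers\<close>

lemma gn_rel_refl: "gn_moderate x \<Longrightarrow> (x, x) \<in> gn_rel"
  by (simp add: gn_rel_def gn_negligible_0)

text \<open>The class of a net that is not moderate is empty, so nonemptiness is what makes the
  choice of \<open>rep\<close> meaningful.\<close>

lemma gn_rel_rep: "gn_class x \<noteq> {} \<Longrightarrow> (x, rep (gn_class x)) \<in> gn_rel"
  by (metis Image_singleton_iff ex_in_conv gn_class_def rep_def someI)

lemma gn_rel_rep_moderate: "gn_moderate x \<Longrightarrow> (x, rep (gn_class x)) \<in> gn_rel"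
  by (rule gn_rel_rep) (use gn_rel_refl in \<open>auto simp: gn_class_def\<close>)

lemma gn_rel_tendsto_0_iff:
  assumes "(x, y) \<in> gn_rel"
  shows "(x \<longlongrightarrow> 0) (at_right 0) \<longleftrightarrow> (y \<longlongrightarrow> 0) (at_right 0)"
proof -
  have "((\<lambda>\<epsilon>. x \<epsilon> - y \<epsilon>) \<longlongrightarrow> 0) (at_right 0)"
    using assms by (auto simp: gn_rel_def intro: gn_negligible_tendsto_0)
  from tendsto_add[OF this, of y 0] tendsto_diff[OF _ this, of x 0] show ?thesis by auto
qed

text \<open>Moderateness is implied on both sides: elements of \<open>gen_numbers\<close> are
  nonempty classes, and a null net is eventually below 1. Integrals and point values can thus be
  treated through their defining nets.\<close>

lemma gn_class_infinitesimal_iff: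
  "gn_class x \<in> gn_infinitesimals \<longleftrightarrow> (x \<longlongrightarrow> 0) (at_right 0)"
proof
  assume *: "gn_class x \<in> gn_infinitesimals"
  then have "gn_class x \<noteq> {}"
    using gn_rel_refl by (fastforce simp: gn_infinitesimals_def gen_numbers_def quotient_def)
  with * show "(x \<longlongrightarrow> 0) (at_right 0)"
    unfolding gn_infinitesimals_def using gn_rel_tendsto_0_iff[OF gn_rel_rep] by blast
next
  assume *: "(x \<longlongrightarrow> 0) (at_right 0)"
  then have "gn_moderate x" by (rule tendsto_0_gn_moderate)
  with * show "gn_class x \<in> gn_infinitesimals"
    using gn_rel_tendsto_0_iff[OF gn_rel_rep_moderate]
    by (auto simp: gn_infinitesimals_def gen_numbers_def gn_class_def intro: quotientI)
qed

section \<open>Suprema and partial derivatives\<close>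

text \<open>The real \<open>Sup\<close> is informative only for sets bounded above, hence the
  hypothesis. The inserted 0 yields nonnegativity even on the empty set.\<close>

lemma sup_norm_upper:
  assumes "bdd_above ((\<lambda>x. norm (f x)) ` S)"
  shows "0 \<le> sup_norm S f" and "x \<in> S \<Longrightarrow> norm (f x) \<le> sup_norm S f"
  using assms unfolding sup_norm_def by (auto intro!: cSup_upper)

lemma sup_norm_least:
  assumes "0 \<le> B" "\<And>x. x \<in> S \<Longrightarrow> norm (f x) \<le> B"
  shows "sup_norm S f \<le> B"
  using assms unfolding sup_norm_def by (intro cSup_least) auto

lemma sup_norm_0: "sup_norm S (\<lambda>x. 0 :: 'b::real_normed_vector) = 0"
proof -
  have "insert 0 ((\<lambda>x. norm (0::'b)) ` S) = {0}" by auto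
  then show ?thesis by (simp only: sup_norm_def cSup_singleton)
qed

section \<open>Partial derivatives of linear combinations\<close>

lemma partials_Nil [simp]: "partials [] f = f"
  by (simp add: partials_def)

lemma partials_Cons: "partials (i # \<beta>) f = partial i (partials \<beta> f)"
  by (simp add: partials_def)

lemma smooth_on_continuous_on:
  assumes "smooth_on \<Omega> f" "S \<subseteq> \<Omega>"
  shows "continuous_on S (partials \<beta> f)"
proof (rule continuous_at_imp_continuous_on, rule ballI)
  fix x assume "x \<in> S"
  then have "partials \<beta> f differentiable (at x)"
    using assms unfolding smooth_on_def by blast
  then show "isCont (partials \<beta> f) x" by (rule differentiable_imp_continuous_within)
qed

lemma smooth_on_bdd_above:
  assumes "smooth_on \<Omega> f" "K \<subseteq> \<Omega>" "compact K"
  shows "bdd_above ((\<lambda>x. norm (partials \<beta> f x)) ` K)"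
proof -
  have "continuous_on K (\<lambda>x. norm (partials \<beta> f x))"
    by (rule continuous_on_norm[OF smooth_on_continuous_on[OF assms(1,2)]])
  from compact_continuous_image[OF this assms(3)] show ?thesis
    by (intro bounded_imp_bdd_above compact_imp_bounded)
qed

text \<open>Both claims go through one induction over all points of \<Omega>, because
  differentiating once more at x uses the formula on a neighbourhood of x. The values 1 and -1 of c
  give sums and differences.\<close>

lemma partials_combine:
  assumes "open \<Omega>" "smooth_on \<Omega> f" "smooth_on \<Omega> g" "x \<in> \<Omega>"
  shows "partials \<beta> (\<lambda>x. f x + c *\<^sub>R g x) x = partials \<beta> f x + c *\<^sub>R partials \<beta> g x"
    and "partials \<beta> (\<lambda>x. f x + c *\<^sub>R g x) differentiable (at x)"
proof -
  have "(\<forall>x\<in>\<Omega>. partials \<beta> (\<lambda>x. f x + c *\<^sub>R g x) x = partials \<beta> f x + c *\<^sub>R partials \<beta> g x) \<and>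
        (\<forall>x\<in>\<Omega>. partials \<beta> (\<lambda>x. f x + c *\<^sub>R g x) differentiable (at x))"
  proof (induction \<beta>)
    case Nil
    have "f differentiable (at x)" "g differentiable (at x)" if "x \<in> \<Omega>" for x
      using assms(2,3) that unfolding smooth_on_def by (metis partials_Nil)+
    then show ?case by (auto intro!: differentiable_add differentiable_scaleR)
  next
    case (Cons i \<beta>)
    let ?h = "partials \<beta> (\<lambda>x. f x + c *\<^sub>R g x)"
    have eq: "partials (i # \<beta>) (\<lambda>x. f x + c *\<^sub>R g x) x =
        partials (i # \<beta>) f x + c *\<^sub>R partials (i # \<beta>) g x" if "x \<in> \<Omega>" for x
    proof -
      have "((\<lambda>x. partials \<beta> f x + c *\<^sub>R partials \<beta> g x) has_derivative
          (\<lambda>v. frechet_derivative (partials \<beta> f) (at x) v +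
            c *\<^sub>R frechet_derivative (partials \<beta> g) (at x) v)) (at x)"
        using assms(2,3) that
        by (intro derivative_intros) (auto simp: smooth_on_def frechet_derivative_works[symmetric])
      then have "(?h has_derivative
          (\<lambda>v. frechet_derivative (partials \<beta> f) (at x) v +
            c *\<^sub>R frechet_derivative (partials \<beta> g) (at x) v)) (at x)"
        \<comment> \<open>The two functions are known to agree only on \<Omega>; as \<Omega> is
          open, they still have the same derivative at x.\<close>
        by (rule has_derivative_transform_within_open[OF _ \<open>open \<Omega>\<close> that]) (simp add: Cons.IH)
      from frechet_derivative_at[OF this, symmetric] show ?thesis
        by (simp add: partials_Cons partial_def)
    qed
    moreover have "partials (i # \<beta>) (\<lambda>x. f x + c *\<^sub>R g x) differentiable (at x)"
      if "x \<in> \<Omega>" for x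
    proof -
      have "(\<lambda>x. partials (i # \<beta>) f x + c *\<^sub>R partials (i # \<beta>) g x) differentiable (at x)"
        using assms(2,3) that unfolding smooth_on_def
        by (intro differentiable_add differentiable_scaleR differentiable_const) auto
      then obtain D where "((\<lambda>x. partials (i # \<beta>) f x + c *\<^sub>R partials (i # \<beta>) g x) has_derivative D) (at x)"
        by (auto simp: differentiable_def)
      then have "(partials (i # \<beta>) (\<lambda>x. f x + c *\<^sub>R g x) has_derivative D) (at x)"
        by (rule has_derivative_transform_within_open[OF _ \<open>open \<Omega>\<close> that]) (simp add: eq)
      then show ?thesis by (rule differentiableI)
    qed
    ultimately show ?case by blast
  qed
  then show "partials \<beta> (\<lambda>x. f x + c *\<^sub>R g x) x = partials \<beta> f x + c *\<^sub>R partials \<beta> g x"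
    and "partials \<beta> (\<lambda>x. f x + c *\<^sub>R g x) differentiable (at x)"
    using assms(4) by auto
qed

lemma smooth_on_combine:
  "open \<Omega> \<Longrightarrow> smooth_on \<Omega> f \<Longrightarrow> smooth_on \<Omega> g \<Longrightarrow> smooth_on \<Omega> (\<lambda>x. f x + c *\<^sub>R g x)"
  unfolding smooth_on_def[of _ "\<lambda>x. f x + c *\<^sub>R g x"] by (auto intro: partials_combine(2))

lemma sup_norm_partials_combine:
  assumes "open \<Omega>" "smooth_on \<Omega> f" "smooth_on \<Omega> g" "K \<subseteq> \<Omega>" "compact K"
  shows "sup_norm K (partials \<beta> (\<lambda>x. f x + c *\<^sub>R g x))
    \<le> (1 + \<bar>c\<bar>) * (sup_norm K (partials \<beta> f) + sup_norm K (partials \<beta> g))"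
proof (rule sup_norm_least)
  note f = sup_norm_upper[OF smooth_on_bdd_above[OF assms(2,4,5), of \<beta>]]
  note g = sup_norm_upper[OF smooth_on_bdd_above[OF assms(3,4,5), of \<beta>]]
  show "0 \<le> (1 + \<bar>c\<bar>) * (sup_norm K (partials \<beta> f) + sup_norm K (partials \<beta> g))"
    using f(1) g(1) by simp
  fix x assume x: "x \<in> K"
  have "norm (partials \<beta> (\<lambda>x. f x + c *\<^sub>R g x) x) \<le> norm (partials \<beta> f x) + \<bar>c\<bar> * norm (partials \<beta> g x)"
    using x assms norm_triangle_ineq[of "partials \<beta> f x" "c *\<^sub>R partials \<beta> g x"]
    by (subst partials_combine(1)[OF assms(1-3)]) auto
  also have "\<dots> \<le> sup_norm K (partials \<beta> f) + \<bar>c\<bar> * sup_norm K (partials \<beta> g)"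
    using f(2)[OF x] g(2)[OF x] by (intro add_mono mult_left_mono) auto
  also have "\<dots> \<le> (1 + \<bar>c\<bar>) * (sup_norm K (partials \<beta> f) + sup_norm K (partials \<beta> g))"
    using f(1) g(1) by (simp add: algebra_simps)
  finally show "norm (partials \<beta> (\<lambda>x. f x + c *\<^sub>R g x) x) \<le> \<dots>" .
qed

lemma partials_0: "partials \<beta> (\<lambda>x. 0) = (\<lambda>x. 0)"
  by (induction \<beta>) (simp_all add: partials_Cons partial_def[abs_def])

lemma smooth_on_0: "smooth_on \<Omega> (\<lambda>x. 0)"
  by (simp add: smooth_on_def partials_0)

section \<open>The algebra of classes of nets\<close>

text \<open>For indices outside ]0,1] nothing bounds the function, and the supremum may be any
  number; hence the eventual form.\<close>

lemma smooth_net_sup_norm_ge_0: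
  fixes f :: "('n::finite, 'k::real_normed_vector) net"
  assumes "\<forall>\<epsilon>\<in>{0<..1}. smooth_on \<Omega> (f \<epsilon>)" "compact K" "K \<subseteq> \<Omega>"
  shows "\<forall>\<^sub>F \<epsilon> in at_right 0. norm (sup_norm K (partials \<beta> (f \<epsilon>))) = sup_norm K (partials \<beta> (f \<epsilon>))"
  using eventually_at_right_0_unit
proof eventually_elim
  case (elim \<epsilon>)
  then have "smooth_on \<Omega> (f \<epsilon>)" using assms(1) by blast
  from sup_norm_upper(1)[OF smooth_on_bdd_above[OF this assms(3,2)]] show ?case by simp
qed

lemma smooth_net_eventually_less_iff:
  fixes f :: "('n::finite, 'k::real_normed_vector) net"
  assumes "\<forall>\<epsilon>\<in>{0<..1}. smooth_on \<Omega> (f \<epsilon>)" "compact K" "K \<subseteq> \<Omega>"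
  shows "(\<forall>\<^sub>F \<epsilon> in at_right 0. norm (sup_norm K (partials \<beta> (f \<epsilon>))) < h \<epsilon>) \<longleftrightarrow>
    (\<forall>\<^sub>F \<epsilon> in at_right 0. sup_norm K (partials \<beta> (f \<epsilon>)) < h \<epsilon>)"
  by (rule eventually_cong[OF smooth_net_sup_norm_ge_0[OF assms, of \<beta>]]) simp

text \<open>Reduces moderate nets of functions to moderate nets of real numbers, so that the
  estimates for numbers apply to each supremum.\<close>

lemma moderate_iff:
  "moderate \<Omega> f \<longleftrightarrow> (\<forall>\<epsilon>\<in>{0<..1}. smooth_on \<Omega> (f \<epsilon>)) \<and>
     (\<forall>K \<beta>. compact K \<and> K \<subseteq> \<Omega> \<longrightarrow> gn_moderate (\<lambda>\<epsilon>. sup_norm K (partials \<beta> (f \<epsilon>))))"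
  unfolding moderate_def gn_moderate_def
  by (intro conj_cong refl all_cong1 imp_cong) (simp add: smooth_net_eventually_less_iff del: real_norm_def)

lemma negligible_net_iff:
  "negligible_net \<Omega> f \<longleftrightarrow> (\<forall>\<epsilon>\<in>{0<..1}. smooth_on \<Omega> (f \<epsilon>)) \<and>
     (\<forall>K \<beta>. compact K \<and> K \<subseteq> \<Omega> \<longrightarrow> gn_negligible (\<lambda>\<epsilon>. sup_norm K (partials \<beta> (f \<epsilon>))))"
  unfolding negligible_net_def gn_negligible_def
  by (intro conj_cong refl all_cong1 imp_cong) (simp add: smooth_net_eventually_less_iff del: real_norm_def)

lemma moderate_smooth: "moderate \<Omega> f \<Longrightarrow> \<epsilon> \<in> {0<..1} \<Longrightarrow> smooth_on \<Omega> (f \<epsilon>)"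
  by (simp add: moderate_def)

lemma moderate_sup_norm:
  assumes "moderate \<Omega> f" "compact K" "K \<subseteq> \<Omega>"
  shows "gn_moderate (\<lambda>\<epsilon>. sup_norm K (partials \<beta> (f \<epsilon>)))"
  using assms unfolding moderate_iff by blast

lemma negligible_net_sup_norm:
  assumes "negligible_net \<Omega> f" "compact K" "K \<subseteq> \<Omega>"
  shows "gn_negligible (\<lambda>\<epsilon>. sup_norm K (partials \<beta> (f \<epsilon>)))"
  using assms unfolding negligible_net_iff by blast

text \<open>Shaped as the domination hypothesis of \<open>gn_moderate_combine\<close> and
  \<open>gn_negligible_combine\<close>.\<close>

lemma net_sup_norm_combine:
  fixes f g :: "('n::finite, 'k::real_normed_vector) net"
  assumes "open \<Omega>" "\<forall>\<epsilon>\<in>{0<..1}. smooth_on \<Omega> (f \<epsilon>)" "\<forall>\<epsilon>\<in>{0<..1}. smooth_on \<Omega> (g \<epsilon>)"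
    and "compact K" "K \<subseteq> \<Omega>"
  shows "\<forall>\<^sub>F \<epsilon> in at_right 0. norm (sup_norm K (partials \<beta> (\<lambda>x. f \<epsilon> x + c *\<^sub>R g \<epsilon> x)))
    \<le> (1 + \<bar>c\<bar>) * (norm (sup_norm K (partials \<beta> (f \<epsilon>))) + norm (sup_norm K (partials \<beta> (g \<epsilon>))))"
proof -
  have fg: "\<forall>\<epsilon>\<in>{0<..1}. smooth_on \<Omega> (\<lambda>x. f \<epsilon> x + c *\<^sub>R g \<epsilon> x)"
    using assms(1-3) by (simp add: smooth_on_combine)
  show ?thesis
    using smooth_net_sup_norm_ge_0[OF assms(2,4,5), of \<beta>]
      smooth_net_sup_norm_ge_0[OF assms(3,4,5), of \<beta>]
      smooth_net_sup_norm_ge_0[OF fg assms(4,5), of \<beta>] eventually_at_right_0_unit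
  proof eventually_elim
    case (elim \<epsilon>)
    have "smooth_on \<Omega> (f \<epsilon>)" "smooth_on \<Omega> (g \<epsilon>)"
      using assms(2,3) elim(4) by blast+
    then show ?case
      unfolding elim(1-3) by (rule sup_norm_partials_combine[OF assms(1) _ _ assms(5,4)])
  qed
qed

lemma moderate_combine:
  assumes "open \<Omega>" "moderate \<Omega> f" "moderate \<Omega> g"
  shows "moderate \<Omega> (\<lambda>\<epsilon> x. f \<epsilon> x + c *\<^sub>R g \<epsilon> x)"
  using assms unfolding moderate_iff
  by (auto intro!: smooth_on_combine gn_moderate_combine[OF _ _ net_sup_norm_combine])

lemma negligible_net_combine:
  assumes "open \<Omega>" "negligible_net \<Omega> f" "negligible_net \<Omega> g"
  shows "negligible_net \<Omega> (\<lambda>\<epsilon> x. f \<epsilon> x + c *\<^sub>R g \<epsilon> x)"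
  using assms unfolding negligible_net_iff
  by (auto intro!: smooth_on_combine gn_negligible_combine[OF _ _ net_sup_norm_combine])

lemma moderate_add:
  "open \<Omega> \<Longrightarrow> moderate \<Omega> f \<Longrightarrow> moderate \<Omega> g \<Longrightarrow> moderate \<Omega> (\<lambda>\<epsilon> x. f \<epsilon> x + g \<epsilon> x)"
  using moderate_combine[of \<Omega> f g 1] by simp

lemma moderate_diff:
  "open \<Omega> \<Longrightarrow> moderate \<Omega> f \<Longrightarrow> moderate \<Omega> g \<Longrightarrow> moderate \<Omega> (\<lambda>\<epsilon> x. f \<epsilon> x - g \<epsilon> x)"
  using moderate_combine[of \<Omega> f g "- 1"] by simp

lemma negligible_net_add:
  "open \<Omega> \<Longrightarrow> negligible_net \<Omega> f \<Longrightarrow> negligible_net \<Omega> g \<Longrightarrow> negligible_net \<Omega> (\<lambda>\<epsilon> x. f \<epsilon> x + g \<epsilon> x)"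
  using negligible_net_combine[of \<Omega> f g 1] by simp

lemma negligible_net_diff:
  "open \<Omega> \<Longrightarrow> negligible_net \<Omega> f \<Longrightarrow> negligible_net \<Omega> g \<Longrightarrow> negligible_net \<Omega> (\<lambda>\<epsilon> x. f \<epsilon> x - g \<epsilon> x)"
  using negligible_net_combine[of \<Omega> f g "- 1"] by simp

lemma moderate_0: "moderate \<Omega> (\<lambda>\<epsilon> x. 0)"
  by (simp add: moderate_iff smooth_on_0 partials_0 sup_norm_0 gn_moderate_0)

lemma negligible_net_0: "negligible_net \<Omega> (\<lambda>\<epsilon> x. 0)"
  by (simp add: negligible_net_iff smooth_on_0 partials_0 sup_norm_0 gn_negligible_0)

text \<open>Symmetry comes from 0 - (f - g) and transitivity from (f - g) + (g - h), both negligible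
  as combinations of negligible nets.\<close>

lemma equiv_gf_rel:
  fixes \<Omega> :: "(real^'n) set"
  assumes "open \<Omega>"
  shows "equiv {f :: ('n, 'k::real_normed_vector) net. moderate \<Omega> f} (gf_rel \<Omega>)"
proof (rule equivI)
  show "refl_on {f :: ('n, 'k) net. moderate \<Omega> f} (gf_rel \<Omega>)"
    by (auto simp: refl_on_def gf_rel_def negligible_net_0)
  show "sym (gf_rel \<Omega> :: (('n, 'k) net \<times> ('n, 'k) net) set)"
  proof (rule symI)
    fix f g :: "('n, 'k) net"
    assume "(f, g) \<in> gf_rel \<Omega>"
    then show "(g, f) \<in> gf_rel \<Omega>"
      using negligible_net_diff[OF assms negligible_net_0, of "\<lambda>\<epsilon> x. f \<epsilon> x - g \<epsilon> x"]
      by (auto simp: gf_rel_def)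
  qed
  show "trans (gf_rel \<Omega> :: (('n, 'k) net \<times> ('n, 'k) net) set)"
  proof (rule transI)
    fix f g h :: "('n, 'k) net"
    assume "(f, g) \<in> gf_rel \<Omega>" "(g, h) \<in> gf_rel \<Omega>"
    then show "(f, h) \<in> gf_rel \<Omega>"
      using negligible_net_add[OF assms, of "\<lambda>\<epsilon> x. f \<epsilon> x - g \<epsilon> x" "\<lambda>\<epsilon> x. g \<epsilon> x - h \<epsilon> x"]
      by (auto simp: gf_rel_def)
  qed
  show "gf_rel \<Omega> \<subseteq> {f :: ('n, 'k) net. moderate \<Omega> f} \<times> {f. moderate \<Omega> f}"
    by (auto simp: gf_rel_def)
qed

section \<open>Classes, representatives and the group operations\<close>

lemma gf_class_in_colombeau: "moderate \<Omega> u \<Longrightarrow> gf_class \<Omega> u \<in> colombeau \<Omega>"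
  unfolding colombeau_def gf_class_def by (rule quotientI) simp

lemma gf_rel_rep:
  assumes "open \<Omega>" "moderate \<Omega> u"
  shows "(u, rep (gf_class \<Omega> u)) \<in> gf_rel \<Omega>"
proof -
  have "u \<in> gf_class \<Omega> u"
    using assms(2) by (simp add: gf_class_def gf_rel_def negligible_net_0)
  then have "rep (gf_class \<Omega> u) \<in> gf_class \<Omega> u"
    unfolding rep_def by (rule someI[of "\<lambda>x. x \<in> gf_class \<Omega> u"])
  then show ?thesis by (simp add: gf_class_def)
qed

lemma colombeau_rep:
  assumes "open \<Omega>" "f \<in> colombeau \<Omega>"
  shows "moderate \<Omega> (rep f)" and "gf_class \<Omega> (rep f) = f"
proof -
  obtain u where u: "moderate \<Omega> u" "f = gf_class \<Omega> u"
    using assms(2) by (auto simp: colombeau_def gf_class_def elim: quotientE)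
  note r = gf_rel_rep[OF assms(1) u(1), folded u(2)]
  then show "moderate \<Omega> (rep f)" by (simp add: gf_rel_def)
  show "gf_class \<Omega> (rep f) = f"
    using equiv_class_eq[OF equiv_gf_rel[OF assms(1)] r] by (simp add: u(2) gf_class_def)
qed

lemma gf_class_eqI: "open \<Omega> \<Longrightarrow> (u, v) \<in> gf_rel \<Omega> \<Longrightarrow> gf_class \<Omega> u = gf_class \<Omega> v"
  unfolding gf_class_def by (rule equiv_class_eq[OF equiv_gf_rel])

text \<open>The operation does not depend on the representatives: the error of the sum is the sum of
  two negligible errors.\<close>

lemma gf_add_class:
  assumes "open \<Omega>" "moderate \<Omega> u" "moderate \<Omega> v"
  shows "gf_add \<Omega> (gf_class \<Omega> u) (gf_class \<Omega> v) = gf_class \<Omega> (\<lambda>\<epsilon> x. u \<epsilon> x + v \<epsilon> x)"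
  unfolding gf_add_def
proof (rule gf_class_eqI[OF assms(1), symmetric])
  let ?u = "rep (gf_class \<Omega> u)" and ?v = "rep (gf_class \<Omega> v)"
  have "(u, ?u) \<in> gf_rel \<Omega>" "(v, ?v) \<in> gf_rel \<Omega>"
    using assms by (auto intro: gf_rel_rep)
  then show "(\<lambda>\<epsilon> x. u \<epsilon> x + v \<epsilon> x, \<lambda>\<epsilon> x. ?u \<epsilon> x + ?v \<epsilon> x) \<in> gf_rel \<Omega>"
    using negligible_net_add[OF assms(1), of "\<lambda>\<epsilon> x. u \<epsilon> x - ?u \<epsilon> x" "\<lambda>\<epsilon> x. v \<epsilon> x - ?v \<epsilon> x"]
    by (auto simp: gf_rel_def algebra_simps intro!: moderate_add assms(1))
qed

lemma gf_diff_class: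
  assumes "open \<Omega>" "moderate \<Omega> u" "moderate \<Omega> v"
  shows "gf_diff \<Omega> (gf_class \<Omega> u) (gf_class \<Omega> v) = gf_class \<Omega> (\<lambda>\<epsilon> x. u \<epsilon> x - v \<epsilon> x)"
  unfolding gf_diff_def
proof (rule gf_class_eqI[OF assms(1), symmetric])
  let ?u = "rep (gf_class \<Omega> u)" and ?v = "rep (gf_class \<Omega> v)"
  have "(u, ?u) \<in> gf_rel \<Omega>" "(v, ?v) \<in> gf_rel \<Omega>"
    using assms by (auto intro: gf_rel_rep)
  then show "(\<lambda>\<epsilon> x. u \<epsilon> x - v \<epsilon> x, \<lambda>\<epsilon> x. ?u \<epsilon> x - ?v \<epsilon> x) \<in> gf_rel \<Omega>"
    using negligible_net_diff[OF assms(1), of "\<lambda>\<epsilon> x. u \<epsilon> x - ?u \<epsilon> x" "\<lambda>\<epsilon> x. v \<epsilon> x - ?v \<epsilon> x"]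
    by (auto simp: gf_rel_def algebra_simps intro!: moderate_diff assms(1))
qed

lemma colombeau_cases:
  assumes "open \<Omega>" "f \<in> colombeau \<Omega>"
  obtains u where "moderate \<Omega> u" "f = gf_class \<Omega> u"
  using colombeau_rep[OF assms] by metis

lemma gf_zero_in_colombeau: "gf_zero \<Omega> \<in> colombeau \<Omega>"
  unfolding gf_zero_def by (intro gf_class_in_colombeau moderate_0)

lemma colombeau_closed:
  assumes "open \<Omega>" "f \<in> colombeau \<Omega>" "g \<in> colombeau \<Omega>"
  shows "gf_add \<Omega> f g \<in> colombeau \<Omega>" and "gf_diff \<Omega> f g \<in> colombeau \<Omega>"
  unfolding gf_add_def gf_diff_def
  using assms by (auto intro!: gf_class_in_colombeau moderate_add moderate_diff colombeau_rep)

text \<open>On the classes of u and v each identity becomes a pointwise one between nets.\<close>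

lemma colombeau_group:
  assumes "open \<Omega>" "f \<in> colombeau \<Omega>" "g \<in> colombeau \<Omega>"
  shows gf_add_zero_left: "gf_add \<Omega> (gf_zero \<Omega>) f = f"
    and gf_diff_zero_right: "gf_diff \<Omega> f (gf_zero \<Omega>) = f"
    and gf_diff_add: "gf_diff \<Omega> (gf_add \<Omega> g f) g = f"
    and gf_add_diff: "gf_add \<Omega> g (gf_diff \<Omega> f g) = f"
proof -
  obtain u v where u: "moderate \<Omega> u" "f = gf_class \<Omega> u" and v: "moderate \<Omega> v" "g = gf_class \<Omega> v"
    using assms by (meson colombeau_cases)
  note simps = gf_zero_def gf_add_class gf_diff_class moderate_0 moderate_add moderate_diff assms(1) u v
  show "gf_add \<Omega> (gf_zero \<Omega>) f = f" "gf_diff \<Omega> f (gf_zero \<Omega>) = f"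
    "gf_diff \<Omega> (gf_add \<Omega> g f) g = f" "gf_add \<Omega> g (gf_diff \<Omega> f g) = f"
    by (simp_all add: simps)
qed

section \<open>Association from uniform convergence\<close>

lemma gf_integral_infinitesimal:
  fixes f :: "('n::finite, 'k::{real_normed_field, euclidean_space}) net set"
  assumes "open \<Omega>" "f \<in> colombeau \<Omega>" "\<phi> \<in> test_functions \<Omega>"
    and "\<And>K. compact K \<Longrightarrow> K \<subseteq> \<Omega> \<Longrightarrow> ((\<lambda>\<epsilon>. sup_norm K (rep f \<epsilon>)) \<longlongrightarrow> 0) (at_right 0)"
  shows "gf_integral \<Omega> f \<phi> \<in> gn_infinitesimals"
  unfolding gf_integral_def gn_class_infinitesimal_iff
proof (rule Lim_null_comparison)
  define K where "K = supp \<phi>"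
  have K: "compact K" "K \<subseteq> \<Omega>" and \<phi>: "smooth_on UNIV \<phi>"
    using assms(3) by (auto simp: test_functions_def K_def)
  have outside: "\<phi> x = 0" if "x \<notin> K" for x
    using that closure_subset[of "{x. \<phi> x \<noteq> 0}"] by (auto simp: K_def supp_def)
  define B where "B = sup_norm K \<phi>"
  have "bdd_above ((\<lambda>x. norm (\<phi> x)) ` K)"
    using smooth_on_bdd_above[OF \<phi> _ K(1), of "[]"] by simp
  note B = sup_norm_upper[OF this, folded B_def]
  have K_finite: "emeasure lborel K < \<infinity>" "K \<in> sets lborel"
    using K(1) emeasure_bounded_finite[OF compact_imp_bounded[OF K(1)]]
    by (auto simp: compact_imp_closed)
  \<comment> \<open>The constant is the supremum of the test function times the volume of its
    support; it does not depend on \<epsilon>.\<close>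
  show "\<forall>\<^sub>F \<epsilon> in at_right 0. norm (LINT x:\<Omega>|lborel. rep f \<epsilon> x * \<phi> x)
      \<le> sup_norm K (rep f \<epsilon>) * (B * measure lborel K)"
    using eventually_at_right_0_unit
  proof eventually_elim
    case (elim \<epsilon>)
    define s where "s = sup_norm K (rep f \<epsilon>)"
    have "smooth_on \<Omega> (rep f \<epsilon>)"
      using colombeau_rep(1)[OF assms(1,2)] elim by (simp add: moderate_iff)
    from smooth_on_bdd_above[OF this K(2,1), of "[]"]
    have "bdd_above ((\<lambda>x. norm (rep f \<epsilon> x)) ` K)" by simp
    note s = sup_norm_upper[OF this, folded s_def]
    have "norm (LINT x:\<Omega>|lborel. rep f \<epsilon> x * \<phi> x)
        \<le> (LINT x|lborel. norm (indicat_real \<Omega> x *\<^sub>R (rep f \<epsilon> x * \<phi> x)))"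
      unfolding set_lebesgue_integral_def by (rule integral_norm_bound)
    also have "\<dots> \<le> (LINT x|lborel. s * B * indicat_real K x)"
    \<comment> \<open>This comparison asks for integrability of the majorant only, a multiple of an
      indicator function of finite measure. Off K the integrand vanishes with \<phi>.\<close>
    proof (rule integral_mono')
      show "integrable lborel (\<lambda>x. s * B * indicat_real K x)"
        using K_finite by auto
      show "norm (indicat_real \<Omega> x *\<^sub>R (rep f \<epsilon> x * \<phi> x)) \<le> s * B * indicat_real K x" for x
        using K(2) s B outside[of x]
        by (cases "x \<in> K") (auto simp: norm_mult indicator_def intro!: mult_mono)
      show "0 \<le> s * B * indicat_real K x" for x
        using s(1) B(1) by simp
    qed
    also have "\<dots> = s * (B * measure lborel K)"
      using K_finite by simp
    finally show ?case by (simp add: s_def)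
  qed
  show "((\<lambda>\<epsilon>. sup_norm K (rep f \<epsilon>) * (B * measure lborel K)) \<longlongrightarrow> 0) (at_right 0)"
    by (intro tendsto_mult_left_zero assms(4) K)
qed

lemma colombeau_0_iff:
  "open \<Omega> \<Longrightarrow> f \<in> colombeau_0 \<Omega> \<longleftrightarrow>
    f \<in> colombeau \<Omega> \<and> (\<forall>\<phi>\<in>test_functions \<Omega>. gf_integral \<Omega> f \<phi> \<in> gn_infinitesimals)"
  by (auto simp: colombeau_0_def associated_def gf_diff_zero_right)

lemma colombeau_0I:
  assumes "open \<Omega>" "f \<in> colombeau \<Omega>"
    and "\<And>K. compact K \<Longrightarrow> K \<subseteq> \<Omega> \<Longrightarrow> ((\<lambda>\<epsilon>. sup_norm K (rep f \<epsilon>)) \<longlongrightarrow> 0) (at_right 0)"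
  shows "f \<in> colombeau_0 \<Omega>"
  using assms by (auto simp: colombeau_0_iff intro: gf_integral_infinitesimal)

text \<open>Since (f + h) - f = h, both associations test the same integrals. This serves the halo
  and the decomposition of \<open>colombeau_as\<close> alike.\<close>

lemma associated_add_iff:
  assumes "open \<Omega>" "f \<in> colombeau \<Omega>" "h \<in> colombeau \<Omega>"
  shows "associated \<Omega> (gf_add \<Omega> f h) f \<longleftrightarrow> h \<in> colombeau_0 \<Omega>"
  using assms by (simp add: associated_def gf_diff_add colombeau_0_iff)

section \<open>Exhaustions and convergence on compact sets\<close>

lemma exhaustion_compact:
  assumes "exhaustion \<Omega> E" "compact K" "K \<subseteq> \<Omega>"
  obtains m where "K \<subseteq> E m"
proof -
  have E: "mono E" "\<And>m. open (E m)" "(\<Union>m. E m) = \<Omega>"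
    using assms(1) by (auto simp: exhaustion_def)
  obtain C where C: "finite C" "K \<subseteq> (\<Union>m\<in>C. E m)"
    using compactE_image[OF assms(2), of UNIV E] E assms(3) by auto
  \<comment> \<open>By monotonicity the largest index of the finite subcover suffices; inserting 0
    keeps \<open>Max\<close> meaningful if C is empty.\<close>
  have "K \<subseteq> E (Max (insert 0 C))"
  proof
    fix x assume "x \<in> K"
    then obtain m where m: "m \<in> C" "x \<in> E m" using C(2) by auto
    then have "m \<le> Max (insert 0 C)" using C(1) by simp
    with m(2) show "x \<in> E (Max (insert 0 C))" using monoD[OF E(1)] by blast
  qed
  then show thesis by (rule that)
qed

text \<open>\<open>E m\<close> itself need not be compact, so boundedness of f on it is taken from
  its compact closure inside \<Omega>.\<close>

lemma exhaustion_sup_norm_bounds: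
  assumes "exhaustion \<Omega> E" "smooth_on \<Omega> f"
  shows "K \<subseteq> E m \<Longrightarrow> sup_norm K f \<le> sup_norm (E m) f"
    and "0 \<le> sup_norm (E m) f"
    and "sup_norm (E m) f \<le> sup_norm (closure (E m)) f"
proof -
  have c: "compact (closure (E m))" "closure (E m) \<subseteq> \<Omega>"
    using assms(1) by (auto simp: exhaustion_def rel_compact_in_def)
  have bc: "bdd_above ((\<lambda>x. norm (f x)) ` closure (E m))"
    using smooth_on_bdd_above[OF assms(2) c(2,1), of "[]"] by simp
  then have b: "bdd_above ((\<lambda>x. norm (f x)) ` E m)"
    by (rule bdd_above_mono) (use closure_subset in blast)
  show "0 \<le> sup_norm (E m) f" by (rule sup_norm_upper[OF b])
  show "K \<subseteq> E m \<Longrightarrow> sup_norm K f \<le> sup_norm (E m) f"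
    by (intro sup_norm_least) (auto intro: sup_norm_upper[OF b])
  show "sup_norm (E m) f \<le> sup_norm (closure (E m)) f"
    using closure_subset by (intro sup_norm_least) (auto intro: sup_norm_upper[OF bc])
qed

lemma exhaustion_sup_norm_tendsto_0:
  assumes "open \<Omega>" "exhaustion \<Omega> E" "f \<in> colombeau \<Omega>"
    and "\<And>m. ((\<lambda>\<epsilon>. sup_norm (E m) (rep f \<epsilon>)) \<longlongrightarrow> 0) (at_right 0)"
    and "compact K" "K \<subseteq> \<Omega>"
  shows "((\<lambda>\<epsilon>. sup_norm K (rep f \<epsilon>)) \<longlongrightarrow> 0) (at_right 0)"
proof -
  obtain m where m: "K \<subseteq> E m" using assms by (metis exhaustion_compact)
  have smooth: "smooth_on \<Omega> (rep f \<epsilon>)" if "\<epsilon> \<in> {0<..1}" for \<epsilon>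
    using colombeau_rep(1)[OF assms(1,3)] that by (simp add: moderate_iff)
  show ?thesis
  proof (rule Lim_null_comparison[OF _ assms(4)[of m]])
    show "\<forall>\<^sub>F \<epsilon> in at_right 0. norm (sup_norm K (rep f \<epsilon>)) \<le> sup_norm (E m) (rep f \<epsilon>)"
      using eventually_at_right_0_unit
    proof eventually_elim
      case (elim \<epsilon>)
      have "0 \<le> sup_norm K (rep f \<epsilon>)"
        using sup_norm_upper(1)[OF smooth_on_bdd_above[OF smooth[OF elim] assms(6,5), of "[]"]] by simp
      with exhaustion_sup_norm_bounds(1)[OF assms(2) smooth[OF elim] m] show ?case by simp
    qed
  qed
qed

section \<open>Sharp topology, norms and point values\<close>

text \<open>A positive supremum is exceeded by no bound 0, so some admissible exponent a is
  positive, and the empty multi-index gives the decay of f itself.\<close>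

lemma valuation_pos_tendsto_0:
  assumes "0 < valuation E m p f"
  shows "((\<lambda>\<epsilon>. sup_norm (E m) (rep f \<epsilon>)) \<longlongrightarrow> 0) (at_right 0)"
proof -
  obtain a where a: "0 < a" and "\<forall>\<beta>. length \<beta> \<le> p \<longrightarrow>
      (\<lambda>\<epsilon>. sup_norm (E m) (partials \<beta> (rep f \<epsilon>))) \<in> o[at_right 0](\<lambda>\<epsilon>. \<epsilon> powr a)"
    using assms by (auto simp: valuation_def less_Sup_iff)
  then have o: "(\<lambda>\<epsilon>. sup_norm (E m) (rep f \<epsilon>)) \<in> o[at_right 0](\<lambda>\<epsilon>. \<epsilon> powr a)"
    by (auto dest: spec[of _ "[]"])
  show ?thesis
  proof (rule Lim_null_comparison)
    show "\<forall>\<^sub>F \<epsilon> in at_right 0. norm (sup_norm (E m) (rep f \<epsilon>)) \<le> \<epsilon> powr a"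
      using landau_o.smallD[OF o, of 1] by simp
    show "((\<lambda>\<epsilon>. \<epsilon> powr a) \<longlongrightarrow> 0) (at_right 0)"
      by (rule tendsto_zero_powrI[OF tendsto_ident_at tendsto_const _ a])
        (auto simp: eventually_at_right_less eventually_at_filter)
  qed
qed

text \<open>At minus infinity \<open>real_of_ereal\<close> is 0 and \<open>exp_minus\<close> is 1,
  so the hypothesis also excludes that value.\<close>

lemma exp_minus_less_1: "exp_minus v < 1 \<Longrightarrow> 0 < v"
  by (cases v) (auto simp: exp_minus_def split: if_splits)

lemma exp_minus_ge_0: "0 \<le> exp_minus v"
  by (simp add: exp_minus_def)

lemma sharp_dist_less_1:
  assumes "sharp_dist \<Omega> E f g < 1"
  shows "0 < valuation E m m (gf_diff \<Omega> f g)"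
proof -
  define d where "d m = sharp_semidist \<Omega> E m m f g" for m
  have d: "0 \<le> d m" for m by (simp add: d_def sharp_semidist_def exp_minus_ge_0)
  \<comment> \<open>The transformed distances stay below 2, so their real supremum is a genuine
    upper bound.\<close>
  have "bdd_above (range (\<lambda>m. 2 * d m / (1 + d m)))"
  proof (rule bdd_aboveI2)
    show "2 * d m / (1 + d m) \<le> 2" for m using d[of m] by (simp add: divide_le_eq)
  qed
  then have "2 * d m / (1 + d m) \<le> sharp_dist \<Omega> E f g"
    unfolding sharp_dist_def d_def by (rule cSUP_upper[rotated]) simp
  with assms have "2 * d m / (1 + d m) < 1" by simp
  \<comment> \<open>For nonnegative t, 2t/(1+t) < 1 means t < 1; this is where the radius 1
    enters.\<close>
  then have "d m < 1" using d[of m] by (simp add: divide_less_eq)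
  then show ?thesis by (auto simp: d_def sharp_semidist_def intro: exp_minus_less_1)
qed

text \<open>Uniform convergence to 0 on a compact set passes between representatives by writing v =
  u - (u - v).\<close>

lemma negligible_diff_sup_norm_tendsto_0:
  assumes "open \<Omega>" "(u, v) \<in> gf_rel \<Omega>" "compact K" "K \<subseteq> \<Omega>"
    and "((\<lambda>\<epsilon>. sup_norm K (u \<epsilon>)) \<longlongrightarrow> 0) (at_right 0)"
  shows "((\<lambda>\<epsilon>. sup_norm K (v \<epsilon>)) \<longlongrightarrow> 0) (at_right 0)"
proof (rule Lim_null_comparison)
  have n: "negligible_net \<Omega> (\<lambda>\<epsilon> x. u \<epsilon> x - v \<epsilon> x)" and u: "moderate \<Omega> u"
    using assms(2) by (auto simp: gf_rel_def)
  have "\<forall>\<^sub>F \<epsilon> in at_right 0. norm (sup_norm K (partials [] (\<lambda>x. u \<epsilon> x + (-1) *\<^sub>R (u \<epsilon> x - v \<epsilon> x))))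
    \<le> (1 + \<bar>-1\<bar>) * (norm (sup_norm K (partials [] (u \<epsilon>)))
        + norm (sup_norm K (partials [] (\<lambda>x. u \<epsilon> x - v \<epsilon> x))))"
    using n u by (intro net_sup_norm_combine[OF assms(1) _ _ assms(3,4)])
      (auto simp: moderate_iff negligible_net_iff)
  then show "\<forall>\<^sub>F \<epsilon> in at_right 0. norm (sup_norm K (v \<epsilon>))
    \<le> 2 * (norm (sup_norm K (u \<epsilon>)) + norm (sup_norm K (\<lambda>x. u \<epsilon> x - v \<epsilon> x)))"
    by simp
  have "gn_negligible (\<lambda>\<epsilon>. sup_norm K (\<lambda>x. u \<epsilon> x - v \<epsilon> x))"
    using negligible_net_sup_norm[OF n assms(3,4), of "[]"] by simp
  then show "((\<lambda>\<epsilon>. 2 * (norm (sup_norm K (u \<epsilon>)) + norm (sup_norm K (\<lambda>x. u \<epsilon> x - v \<epsilon> x)))) \<longlongrightarrow> 0)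
      (at_right 0)"
    by (intro tendsto_mult_right_zero tendsto_add_zero tendsto_norm_zero assms(5))
      (rule gn_negligible_tendsto_0)
qed

lemma unit_ball_zero_subset_colombeau_0:
  fixes h :: "('n::finite, 'k::{real_normed_field, euclidean_space}) net set"
  assumes "open \<Omega>" "exhaustion \<Omega> E" "h \<in> unit_ball \<Omega> E (gf_zero \<Omega>)"
  shows "h \<in> colombeau_0 \<Omega>"
proof (rule colombeau_0I[OF assms(1)])
  show h: "h \<in> colombeau \<Omega>" using assms(3) by (simp add: unit_ball_def)
  note mod_h = colombeau_rep[OF assms(1) h]
  \<comment> \<open>The distance from 0 to h involves 0 - h, whose chosen representative is merely
    equivalent to the negative of \<open>rep h\<close>. The sign disappears in the norm at the
    end.\<close>
  define d where "d = gf_diff \<Omega> (gf_zero \<Omega>) h"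
  have "gf_diff \<Omega> (gf_class \<Omega> (\<lambda>\<epsilon> x. 0)) (gf_class \<Omega> (rep h)) = gf_class \<Omega> (\<lambda>\<epsilon> x. 0 - rep h \<epsilon> x)"
    by (rule gf_diff_class[OF assms(1) moderate_0 mod_h(1)])
  then have "d = gf_class \<Omega> (\<lambda>\<epsilon> x. 0 - rep h \<epsilon> x)"
    by (simp add: d_def gf_zero_def mod_h(2))
  then have r: "(rep d, \<lambda>\<epsilon> x. 0 - rep h \<epsilon> x) \<in> gf_rel \<Omega>"
    using gf_rel_rep[OF assms(1) moderate_diff[OF assms(1) moderate_0 mod_h(1)]]
      equivE[OF equiv_gf_rel[OF assms(1)]] by (blast dest: symD)
  have d: "d \<in> colombeau \<Omega>"
    unfolding d_def by (intro colombeau_closed gf_zero_in_colombeau assms(1) h)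
  have "((\<lambda>\<epsilon>. sup_norm (E m) (rep d \<epsilon>)) \<longlongrightarrow> 0) (at_right 0)" for m
    using assms(3) by (auto simp: unit_ball_def d_def
        intro: valuation_pos_tendsto_0 sharp_dist_less_1)
  note * = exhaustion_sup_norm_tendsto_0[OF assms(1,2) d this]
  fix K assume K: "compact K" "K \<subseteq> \<Omega>"
  from negligible_diff_sup_norm_tendsto_0[OF assms(1) r K *[OF K]]
  show "((\<lambda>\<epsilon>. sup_norm K (rep h \<epsilon>)) \<longlongrightarrow> 0) (at_right 0)"
    by (simp add: sup_norm_def)
qed

lemma gf_norm_infinitesimal_colombeau_0:
  fixes f :: "('n::finite, 'k::{real_normed_field, euclidean_space}) net set"
  assumes "open \<Omega>" "exhaustion \<Omega> E" "f \<in> colombeau \<Omega>"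
    and "\<And>m. (gn_of_real (gf_norm E m f) :: (real \<Rightarrow> 'k) set) \<in> gn_infinitesimals"
  shows "f \<in> colombeau_0 \<Omega>"
proof (rule colombeau_0I[OF assms(1,3) exhaustion_sup_norm_tendsto_0[OF assms(1-3)]])
  fix m
  let ?s = "\<lambda>\<epsilon>. sup_norm (E m) (rep f \<epsilon>)"
  have mod: "moderate \<Omega> (rep f)" by (rule colombeau_rep[OF assms(1,3)])
  \<comment> \<open>A net of norms that is not moderate would have the empty class, and
    \<open>rep\<close> would say nothing about it. Comparison with the compact closure rules this
    out.\<close>
  have "gn_moderate (\<lambda>\<epsilon>. sup_norm (closure (E m)) (rep f \<epsilon>))"
    using moderate_sup_norm[OF mod, of "closure (E m)" "[]"] assms(2)
    by (simp add: exhaustion_def rel_compact_in_def)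
  moreover have "\<forall>\<^sub>F \<epsilon> in at_right 0. norm (?s \<epsilon>) \<le> norm (sup_norm (closure (E m)) (rep f \<epsilon>))"
    using eventually_at_right_0_unit
  proof eventually_elim
    case (elim \<epsilon>)
    then have "smooth_on \<Omega> (rep f \<epsilon>)" by (rule moderate_smooth[OF mod])
    from exhaustion_sup_norm_bounds(2,3)[OF assms(2) this, of m] show ?case by simp
  qed
  ultimately have "gn_moderate ?s" by (rule gn_moderate_le)
  then have "(?s, rep (gf_norm E m f)) \<in> gn_rel"
    unfolding gf_norm_def by (rule gn_rel_rep_moderate)
  moreover have "((\<lambda>\<epsilon>. of_real (rep (gf_norm E m f) \<epsilon>) :: 'k) \<longlongrightarrow> 0) (at_right 0)"
    using assms(4)[of m] by (simp add: gn_of_real_def gn_class_infinitesimal_iff)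
  then have "((\<lambda>\<epsilon>. norm (of_real (rep (gf_norm E m f) \<epsilon>) :: 'k)) \<longlongrightarrow> 0) (at_right 0)"
    by (rule tendsto_norm_zero)
  then have "(rep (gf_norm E m f) \<longlongrightarrow> 0) (at_right 0)"
    by (simp add: tendsto_rabs_zero_iff)
  ultimately show "(?s \<longlongrightarrow> 0) (at_right 0)"
    using gn_rel_tendsto_0_iff by blast
qed

section \<open>Point values at maximum points\<close>

lemma lipschitz_partials:
  fixes f :: "real^'n \<Rightarrow> 'k::real_normed_vector"
  assumes "smooth_on \<Omega> f" "compact K" "cball x e \<subseteq> K" "K \<subseteq> \<Omega>" "y \<in> cball x e"
  shows "norm (f y - f x) \<le> (\<Sum>i\<in>UNIV. sup_norm K (partials [i] f)) * norm (y - x)"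
\<comment> \<open>The mean value inequality on the convex ball. Suprema over K instead of the ball
  give one constant for all centres.\<close>
proof (rule differentiable_bound[of "cball x e" f "\<lambda>z. frechet_derivative f (at z)"])
  have e: "0 \<le> e" using assms(5) by (metis dist_le_zero_iff mem_cball order_trans zero_le_dist)
  then show "x \<in> cball x e" by simp
  fix z assume z: "z \<in> cball x e"
  then have "z \<in> \<Omega>" "z \<in> K" using assms by auto
  then have D: "f differentiable (at z)"
    using assms(1) unfolding smooth_on_def by (auto dest: spec[of _ "[]"])
  then show "(f has_derivative frechet_derivative f (at z)) (at z within cball x e)"
    by (simp add: frechet_derivative_works has_derivative_at_withinI)
  interpret L: linear "frechet_derivative f (at z)"
    using D by (rule linear_frechet_derivative)
  show "onorm (frechet_derivative f (at z)) \<le> (\<Sum>i\<in>UNIV. sup_norm K (partials [i] f))"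
  proof (rule onorm_le)
    fix v :: "real^'n"
    \<comment> \<open>Expanding v in the standard basis bounds the operator norm by the partial
      derivatives, each coordinate of v being at most \<open>norm v\<close>.\<close>
    have "frechet_derivative f (at z) v = frechet_derivative f (at z) (\<Sum>i\<in>UNIV. v $ i *\<^sub>R axis i 1)"
      using basis_expansion[of v] by (simp add: scalar_mult_eq_scaleR)
    also have "\<dots> = (\<Sum>i\<in>UNIV. v $ i *\<^sub>R partials [i] f z)"
      by (simp add: L.sum L.scale partials_Cons partial_def)
    also have "norm \<dots> \<le> (\<Sum>i\<in>UNIV. sup_norm K (partials [i] f) * norm v)"
    proof (rule sum_norm_le)
      fix i
      have "norm (partials [i] f z) \<le> sup_norm K (partials [i] f)"
        by (rule sup_norm_upper(2)[OF smooth_on_bdd_above[OF assms(1,4,2)] \<open>z \<in> K\<close>])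
      then have "\<bar>v $ i\<bar> * norm (partials [i] f z) \<le> norm v * sup_norm K (partials [i] f)"
        by (intro mult_mono component_le_norm_cart) auto
      then show "norm (v $ i *\<^sub>R partials [i] f z) \<le> sup_norm K (partials [i] f) * norm v"
        by (simp add: mult.commute)
    qed
    finally show "norm (frechet_derivative f (at z) v) \<le> (\<Sum>i\<in>UNIV. sup_norm K (partials [i] f)) * norm v"
      by (simp add: sum_distrib_right)
  qed
qed (use assms in auto)

text \<open>For each compact K, maximum points for all \<epsilon> form one net, so the value at a
  single generalized point controls the suprema over K.\<close>

lemma gf_image_infinitesimal_colombeau_0:
  fixes f :: "('n::finite, 'k::{real_normed_field, euclidean_space}) net set"
  assumes "open \<Omega>" "f \<in> colombeau \<Omega>" "gf_image \<Omega> f \<subseteq> gn_infinitesimals"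
  shows "f \<in> colombeau_0 \<Omega>"
proof (rule colombeau_0I[OF assms(1,2)])
  fix K assume K: "compact K" "K \<subseteq> \<Omega>"
  have mod: "moderate \<Omega> (rep f)" by (rule colombeau_rep[OF assms(1,2)])
  then have smooth: "smooth_on \<Omega> (rep f \<epsilon>)" if "\<epsilon> \<in> {0<..1}" for \<epsilon>
    using that by (simp add: moderate_iff)
  show "((\<lambda>\<epsilon>. sup_norm K (rep f \<epsilon>)) \<longlongrightarrow> 0) (at_right 0)"
  proof (cases "K = {}")
    case True
    then show ?thesis by (simp add: sup_norm_def)
  next
    case False
    \<comment> \<open>A maximum is required only for indices in ]0,1], where f is continuous;
      elsewhere any point of K keeps the net inside K.\<close>
    have "\<exists>x. x \<in> K \<and> (\<epsilon> \<in> {0<..1} \<longrightarrow> (\<forall>y\<in>K. norm (rep f \<epsilon> y) \<le> norm (rep f \<epsilon> x)))" for \<epsilon>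
    proof (cases "\<epsilon> \<in> {0<..1}")
      case True
      have "continuous_on K (\<lambda>y. norm (rep f \<epsilon> y))"
        using smooth_on_continuous_on[OF smooth[OF True] K(2), of "[]"] by (auto intro: continuous_on_norm)
      from continuous_attains_sup[OF K(1) False this] show ?thesis by blast
    qed (use False in auto)
    then have "\<exists>x. \<forall>\<epsilon>. x \<epsilon> \<in> K \<and> (\<epsilon> \<in> {0<..1} \<longrightarrow> (\<forall>y\<in>K. norm (rep f \<epsilon> y) \<le> norm (rep f \<epsilon> (x \<epsilon>))))"
      by (intro choice allI)
    then obtain x where x: "\<And>\<epsilon>. x \<epsilon> \<in> K"
      and max: "\<And>\<epsilon> y. \<epsilon> \<in> {0<..1} \<Longrightarrow> y \<in> K \<Longrightarrow> norm (rep f \<epsilon> y) \<le> norm (rep f \<epsilon> (x \<epsilon>))"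
      by blast
    obtain b where "\<And>y. y \<in> K \<Longrightarrow> norm y \<le> b"
      using compact_imp_bounded[OF K(1)] by (auto simp: bounded_iff)
    then have mod_x: "gn_moderate x"
      using x by (intro gn_moderate_bounded[of x b]) auto
    define y where "y = rep (gn_class x)"
    have "gn_class x \<in> compact_points \<Omega>"
    proof -
      have "rel_compact_in K \<Omega>" "\<forall>\<^sub>F \<epsilon> in at_right 0. x \<epsilon> \<in> K"
        using K x by (simp_all add: rel_compact_in_def compact_imp_closed)
      with mod_x show ?thesis unfolding compact_points_def by blast
    qed
    then have "gf_eval f (gn_class x) \<in> gn_infinitesimals"
      using assms(3) by (auto simp: gf_image_def)
    then have fy: "((\<lambda>\<epsilon>. rep f \<epsilon> (y \<epsilon>)) \<longlongrightarrow> 0) (at_right 0)"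
      by (simp add: gf_eval_def y_def gn_class_infinitesimal_iff)
    \<comment> \<open>The representative \<open>y\<close> of the class of \<open>x\<close> may leave \<open>K\<close>; moderate derivatives on a compact
      neighbourhood of \<open>K\<close> control the difference of the values.\<close>
    have neg: "gn_negligible (\<lambda>\<epsilon>. x \<epsilon> - y \<epsilon>)"
      using gn_rel_rep_moderate[OF mod_x] by (simp add: gn_rel_def y_def)
    obtain e where e: "0 < e" "(\<Union>z\<in>K. cball z e) \<subseteq> \<Omega>"
      using compact_subset_open_imp_cball_epsilon_subset[OF K(1) assms(1) K(2)] by auto
    \<comment> \<open>As the sum of two compact sets K' is compact; as a union of balls it lies in
      \<Omega>.\<close>
    define K' where "K' = {z + v | z v. z \<in> K \<and> v \<in> cball 0 e}"
    have K': "compact K'" unfolding K'_def by (intro compact_sums K(1) compact_cball)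
    have K'_eq: "K' = (\<Union>z\<in>K. cball z e)"
    proof (intro equalityI subsetI)
      fix w assume "w \<in> (\<Union>z\<in>K. cball z e)"
      then obtain z where z: "z \<in> K" "w \<in> cball z e" by blast
      then have "w = z + (w - z)" "w - z \<in> cball 0 e"
        by (simp_all add: dist_norm norm_minus_commute)
      with z(1) show "w \<in> K'" unfolding K'_def by blast
    next
      fix w assume "w \<in> K'"
      then obtain z v where z: "z \<in> K" "v \<in> cball 0 e" "w = z + v" unfolding K'_def by blast
      then have "w \<in> cball z e" by (simp add: dist_norm)
      with z(1) show "w \<in> (\<Union>z\<in>K. cball z e)" by blast
    qed
    \<comment> \<open>A common Lipschitz constant on all balls of radius e around points of K. It is
      moderate, so its product with the negligible distance tends to 0.\<close>
    define B where "B \<epsilon> = (\<Sum>i\<in>UNIV. sup_norm K' (partials [i] (rep f \<epsilon>)))" for \<epsilon>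
    have "gn_moderate B"
      unfolding B_def using K' e(2) K'_eq by (intro gn_moderate_sum moderate_sup_norm[OF mod]) auto
    moreover have "gn_negligible (\<lambda>\<epsilon>. norm (x \<epsilon> - y \<epsilon>))"
      using neg by (simp add: gn_negligible_def)
    ultimately have B: "((\<lambda>\<epsilon>. B \<epsilon> * norm (x \<epsilon> - y \<epsilon>)) \<longlongrightarrow> 0) (at_right 0)"
      by (intro gn_negligible_tendsto_0 gn_negligible_mult_moderate)
    have close: "\<forall>\<^sub>F \<epsilon> in at_right 0. norm (x \<epsilon> - y \<epsilon>) < e"
      using gn_negligible_tendsto_0[OF neg] e(1) by (auto simp: tendsto_iff)
    show ?thesis
    proof (rule Lim_null_comparison)
      show "\<forall>\<^sub>F \<epsilon> in at_right 0. norm (sup_norm K (rep f \<epsilon>))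
          \<le> norm (rep f \<epsilon> (y \<epsilon>)) + B \<epsilon> * norm (x \<epsilon> - y \<epsilon>)"
        using eventually_at_right_0_unit close
      proof eventually_elim
        case (elim \<epsilon>)
        \<comment> \<open>The ball is centred at the maximum point, which lies in K; eventually it
          contains \<open>y \<epsilon>\<close>.\<close>
        have "norm (rep f \<epsilon> (y \<epsilon>) - rep f \<epsilon> (x \<epsilon>)) \<le> B \<epsilon> * norm (y \<epsilon> - x \<epsilon>)"
          unfolding B_def using elim K'_eq e(2) x[of \<epsilon>]
          by (intro lipschitz_partials[OF smooth[OF elim(1)] K', of _ e])
            (auto simp: dist_norm)
        moreover have "norm (rep f \<epsilon> (x \<epsilon>)) \<le> norm (rep f \<epsilon> (y \<epsilon>)) +
            norm (rep f \<epsilon> (y \<epsilon>) - rep f \<epsilon> (x \<epsilon>))"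
          by (metis norm_minus_commute norm_triangle_sub)
        moreover have "sup_norm K (rep f \<epsilon>) \<le> norm (rep f \<epsilon> (x \<epsilon>))"
          by (intro sup_norm_least max elim) auto
        moreover have "0 \<le> sup_norm K (rep f \<epsilon>)"
          using sup_norm_upper(1)[OF smooth_on_bdd_above[OF smooth[OF elim(1)] K(2,1), of "[]"]] by simp
        ultimately show ?case by (simp add: norm_minus_commute)
      qed
      show "((\<lambda>\<epsilon>. norm (rep f \<epsilon> (y \<epsilon>)) + B \<epsilon> * norm (x \<epsilon> - y \<epsilon>)) \<longlongrightarrow> 0) (at_right 0)"
        by (intro tendsto_add_zero tendsto_norm_zero fy B)
    qed
  qed
qed

theorem proposition1:
  fixes \<Omega> :: "(real^'n) set"
    and E :: "nat \<Rightarrow> (real^'n) set"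
    and \<rho> :: "real^'n \<Rightarrow> 'k::{real_normed_field, euclidean_space}"
    and f g :: "('n, 'k) net set"
  assumes "open \<Omega>"
    and "exhaustion \<Omega> E"
    and "mollifier \<rho>"
    and "f \<in> colombeau \<Omega>"
    and "g \<in> colombeau \<Omega>"
  shows "(g \<in> halo \<Omega> E f \<longrightarrow> associated \<Omega> g f) \<and>
    (unit_ball \<Omega> E (gf_zero \<Omega>) = halo \<Omega> E (gf_zero \<Omega> :: ('n, 'k) net set) \<and>
     halo \<Omega> E (gf_zero \<Omega>) \<subseteq> (colombeau_0 \<Omega> :: ('n, 'k) net set set)) \<and>
    ((\<forall>m. (gn_of_real (gf_norm E m f) :: (real \<Rightarrow> 'k) set) \<in> gn_infinitesimals) \<longrightarrow>
     f \<in> colombeau_0 \<Omega>) \<and>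
    (gf_image \<Omega> f \<subseteq> gn_infinitesimals \<longrightarrow> f \<in> colombeau_0 \<Omega>) \<and>
    colombeau_as \<rho> \<Omega> = {gf_add \<Omega> t h | t h. t \<in> distributions \<rho> \<Omega> \<and> h \<in> colombeau_0 \<Omega>}"
proof -
  note \<Omega> = assms(1)
  have unit_ball: "h \<in> colombeau \<Omega>" "h \<in> colombeau_0 \<Omega>"
    if "h \<in> unit_ball \<Omega> E (gf_zero \<Omega>)" for h :: "('n, 'k) net set"
    using that unit_ball_zero_subset_colombeau_0[OF \<Omega> assms(2)] by (auto simp: unit_ball_def)
  have 1: "associated \<Omega> g f" if "g \<in> halo \<Omega> E f"
    using that unit_ball associated_add_iff[OF \<Omega> assms(4)] by (auto simp: halo_def)
  have 2: "halo \<Omega> E (gf_zero \<Omega>) = unit_ball \<Omega> E (gf_zero \<Omega> :: ('n, 'k) net set)"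
    using unit_ball gf_add_zero_left[OF \<Omega>] by (force simp: halo_def)
  have 5: "colombeau_as \<rho> \<Omega> = {gf_add \<Omega> t h | t h. t \<in> distributions \<rho> \<Omega> \<and> h \<in> colombeau_0 \<Omega>}"
  proof (intro equalityI subsetI)
    have dist: "t \<in> colombeau \<Omega>" if "t \<in> distributions \<rho> \<Omega>" for t
      using that by (auto simp: distributions_def embeds_def)
    fix a :: "('n, 'k) net set"
    {
      assume "a \<in> colombeau_as \<rho> \<Omega>"
      then obtain t where t: "a \<in> colombeau \<Omega>" "t \<in> distributions \<rho> \<Omega>" "associated \<Omega> a t"
        by (auto simp: colombeau_as_def)
      \<comment> \<open>The difference is the natural summand: since a = t + h, association of a
        with t says exactly that h is associated with 0.\<close>
      define h where "h = gf_diff \<Omega> a t"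
      have h: "h \<in> colombeau \<Omega>" "gf_add \<Omega> t h = a"
        unfolding h_def
        using colombeau_closed(2)[OF \<Omega>] gf_add_diff[OF \<Omega>] t(1) dist[OF t(2)] by blast+
      then have "h \<in> colombeau_0 \<Omega>"
        using t dist associated_add_iff[OF \<Omega>] by metis
      with t h show "a \<in> {gf_add \<Omega> t h | t h. t \<in> distributions \<rho> \<Omega> \<and> h \<in> colombeau_0 \<Omega>}"
        by blast
    }
    assume "a \<in> {gf_add \<Omega> t h | t h. t \<in> distributions \<rho> \<Omega> \<and> h \<in> colombeau_0 \<Omega>}"
    then obtain t h where a: "a = gf_add \<Omega> t h" "t \<in> distributions \<rho> \<Omega>" "h \<in> colombeau_0 \<Omega>"
      by blast
    then have h: "h \<in> colombeau \<Omega>" by (simp add: colombeau_0_def)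
    show "a \<in> colombeau_as \<rho> \<Omega>"
      unfolding colombeau_as_def a(1) using a(2,3) dist h
      by (auto intro!: colombeau_closed(1)[OF \<Omega>] bexI[of _ t] simp: associated_add_iff[OF \<Omega>])
  qed
  show ?thesis
    using 1 2 5 unit_ball gf_norm_infinitesimal_colombeau_0[OF \<Omega> assms(2,4)]
      gf_image_infinitesimal_colombeau_0[OF \<Omega> assms(4)] by auto
qed

end
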